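(* The critical exponent for $5$-by-$5$ matrices is $m(5)=3$.
   Context: A real $n$-by-$n$ matrix is doubly nonnegative if it is symmetric, positive semidefinite, and entry-wise nonnegative. For positive semidefinite $A=\sum_i\lambda_ix_ix_i^T$ (orthonormal eigenvectors) and $t>0$, $A^t=\sum_i\lambda_i^tx_ix_i^T$. The (conventional) critical exponent $m(n)$ is the least value $m$ such that $A^t$ is doubly nonnegative for all $t\ge m$ and all $n$-by-$n$ doubly nonnegative matrices $A$. *)

theory Defs
  imports "HOL-Analysis.Analysis" "HOL-Library.Numeral_Type"
begin

definition doubly_nonneg :: "real^'n^'n \<Rightarrow> bool" where
  "doubly_nonneg A \<longleftrightarrow>
     transpose A = A \<and> (\<forall>x. 0 \<le> x \<bullet> (A *v x)) \<and> (\<forall>i j. 0 \<le> A $ i $ j)"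

definition psd_pow :: "real^'n^'n \<Rightarrow> real \<Rightarrow> real^'n^'n" where
  "psd_pow A t = (SOME B. \<exists>U (lam :: 'n \<Rightarrow> real).
      orthogonal_matrix U \<and> (\<forall>k. 0 \<le> lam k) \<and>
      A = (\<chi> i j. \<Sum>k\<in>UNIV. lam k * U $ i $ k * U $ j $ k) \<and>
      B = (\<chi> i j. \<Sum>k\<in>UNIV. lam k powr t * U $ i $ k * U $ j $ k))"

text \<open>The critical exponent for n-by-n matrices (n = CARD('n)) is the least m such that
  A^t is doubly nonnegative for all t \<ge> m (t > 0) and all doubly nonnegative A.\<close>
definition crit_exp_set :: "('n::finite) itself \<Rightarrow> real set" where
  "crit_exp_set _ = {m. \<forall>t. m \<le> t \<and> 0 < t \<longrightarrow>
      (\<forall>A :: real^'n^'n. doubly_nonneg A \<longrightarrow> doubly_nonneg (psd_pow A t))}"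

end

theory Submission
  imports Defs "HOL-Computational_Algebra.Polynomial"
begin

text \<open>Upper bound, following Micchelli and Willoughby. Let \<open>\<lambda>\<^sub>0 \<le> \<lambda>\<^sub>1 \<le> \<dots>\<close> be the eigenvalues of an
  \<open>n\<close>-by-\<open>n\<close> symmetric matrix \<open>A\<close> with nonnegative off-diagonal entries. Newton interpolation of
  \<open>x\<^sup>t\<close> at the eigenvalues writes \<open>A\<^sup>t\<close> as a combination of the products
  \<open>(A - \<lambda>\<^sub>0) \<cdots> (A - \<lambda>\<^sub>k\<^sub>-\<^sub>1)\<close> with \<open>k < n\<close>. The coefficients are divided differences of order
  below \<open>n\<close>, which are nonnegative for \<open>t \<ge> n - 2\<close>. The products are entrywise nonnegative, by
  induction on principal submatrices: the off-diagonal entries of column \<open>e\<close> of the adjugate of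
  \<open>z - A\<close> have these products as coefficients with respect to the polynomials
  \<open>(z - \<lambda>\<^sub>k\<^sub>+\<^sub>1) \<cdots> (z - \<lambda>\<^sub>n\<^sub>-\<^sub>1)\<close>; eliminating \<open>e\<close> expresses them through the adjugate of the principal
  submatrix without \<open>e\<close>, and eigenvalue interlacing makes the change of basis nonnegative.

  Lower bound: for \<open>A = I + B/2\<close>, where \<open>B\<close> is the adjacency matrix of the path on five vertices,
  the corner entry of \<open>A\<^sup>t\<close> has the sign of \<open>t (t - 1) (t - 2) (t - 3)\<close> for \<open>2 < t < 3\<close>.\<close>

section \<open>Spectral decomposition on a subspace and interlacing\<close>

text \<open>An orthonormal eigenbasis of the compression of \<open>A\<close> to \<open>V\<close>, eigenvalues in increasing order.\<close>

definition spectral_system ::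
    "real^'n^'n \<Rightarrow> (real^'n) set \<Rightarrow> nat \<Rightarrow> (nat \<Rightarrow> real^'n) \<Rightarrow> (nat \<Rightarrow> real) \<Rightarrow> bool" where
  "spectral_system A V n v l \<longleftrightarrow>
     (\<forall>i<n. v i \<in> V) \<and>
     (\<forall>i<n. \<forall>j<n. v i \<bullet> v j = (if i = j then 1 else 0)) \<and>
     (\<forall>x\<in>V. x = (\<Sum>i<n. (x \<bullet> v i) *\<^sub>R v i)) \<and>
     (\<forall>i<n. \<forall>x\<in>V. x \<bullet> (A *v v i) = l i * (x \<bullet> v i)) \<and>
     (\<forall>i j. i \<le> j \<longrightarrow> j < n \<longrightarrow> l i \<le> l j)"

lemma symmetric_dot:
  fixes A :: "real^'n^'n"
  assumes "transpose A = A"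
  shows "x \<bullet> (A *v y) = y \<bullet> (A *v x)"
  by (metis assms dot_lmul_matrix inner_commute transpose_matrix_vector)

text \<open>First-order optimality: the form
  \<open>x \<bullet> (A *v x) - c * (x \<bullet> x)\<close> is nonnegative on \<open>V\<close> and
  vanishes at \<open>v\<close>, so along \<open>v + s *\<^sub>R x\<close> it is a nonnegative
  quadratic in \<open>s\<close> without constant term, and its linear coefficient must
  vanish.\<close>

lemma psd_null_vector:
  fixes A :: "real^'n^'n"
  assumes sym: "transpose A = A" and V: "subspace V"
    and q: "\<And>x. x \<in> V \<Longrightarrow> c * (x \<bullet> x) \<le> x \<bullet> (A *v x)"
    and v: "v \<in> V" "v \<bullet> (A *v v) = c * (v \<bullet> v)" and x: "x \<in> V"
  shows "x \<bullet> (A *v v) = c * (x \<bullet> v)"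
proof (rule ccontr)
  define B where "B = x \<bullet> (A *v v) - c * (x \<bullet> v)"
  define C where "C = x \<bullet> (A *v x) - c * (x \<bullet> x)"
  assume "x \<bullet> (A *v v) \<noteq> c * (x \<bullet> v)"
  then have B: "B \<noteq> 0" by (simp add: B_def)
  have C: "C \<ge> 0" using q[OF x] by (simp add: C_def)
  have ge: "0 \<le> 2 * s * B + s\<^sup>2 * C" for s
  proof -
    have "v + s *\<^sub>R x \<in> V" using V v x by (simp add: subspace_add subspace_scale)
    from q[OF this] show ?thesis
      using v(2) symmetric_dot[OF sym, of v x]
      by (simp add: B_def C_def inner_add_left inner_add_right matrix_vector_right_distrib
          matrix_vector_mult_scaleR power2_eq_square algebra_simps inner_commute)
  qed
  \<comment> \<open>Close to the minimiser \<open>- B / C\<close>; the added 1 keeps the denominator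
    positive when \<open>C = 0\<close>.\<close>
  have "0 \<le> 2 * (- B / (C + 1)) * B + (- B / (C + 1))\<^sup>2 * C" by (rule ge)
  also have "\<dots> = B\<^sup>2 * (- 2 * (C + 1) + C) / (C + 1)\<^sup>2"
  proof -
    have "C + 1 \<noteq> 0" using C by simp
    then show ?thesis by (simp add: divide_simps power2_eq_square) (simp add: algebra_simps)
  qed
  also have "\<dots> < 0"
    using B C by (intro divide_neg_pos mult_pos_neg) (auto simp: zero_less_power2)
  finally show False by simp
qed

text \<open>Induction on the dimension: a minimiser of the quadratic form on the unit sphere of
  \<open>V\<close> is an eigenvector of the compression, and the rest is found in its orthogonal
  complement inside \<open>V\<close>. Minimising makes the eigenvalues increase.\<close>

lemma spectral_system_exists:
  fixes A :: "real^'n^'n"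
  assumes sym: "transpose A = A" and "subspace V"
  shows "\<exists>v l. spectral_system A V (dim V) v l"
  using \<open>subspace V\<close>
proof (induction "dim V" arbitrary: V)
  case 0
  then have "V \<subseteq> {0}" by (metis dim_eq_0)
  then have "spectral_system A V 0 (\<lambda>_. 0) (\<lambda>_. 0)"
    by (auto simp: spectral_system_def)
  then show ?case using 0(1) by metis
next
  case (Suc n)
  let ?K = "V \<inter> sphere 0 1"
  have "\<not> V \<subseteq> {0}" using Suc(2) by (metis Zero_not_Suc dim_eq_0)
  then obtain a where a: "a \<in> V" "a \<noteq> 0" by auto
  have "a /\<^sub>R norm a \<in> ?K" using a Suc.prems by (simp add: subspace_scale)
  then have ne: "?K \<noteq> {}" by blast
  have comp: "compact ?K" by (simp add: Suc.prems closed_subspace closed_Int_compact)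
  have "continuous_on ?K (\<lambda>x. x \<bullet> (A *v x))"
    by (intro continuous_intros linear_continuous_on bounded_linear_intros
        matrix_vector_mul_bounded_linear)
  then obtain u where u: "u \<in> ?K" and umin: "\<And>x. x \<in> ?K \<Longrightarrow> u \<bullet> (A *v u) \<le> x \<bullet> (A *v x)"
    using continuous_attains_inf[OF comp ne] by blast
  define c where "c = u \<bullet> (A *v u)"
  have uu: "u \<bullet> u = 1" using u by (simp add: dot_square_norm)
  have uV: "u \<in> V" using u by simp
  have q: "c * (x \<bullet> x) \<le> x \<bullet> (A *v x)" if "x \<in> V" for x
  proof (cases "x = 0")
    case False
    have "x /\<^sub>R norm x \<in> ?K" using False that Suc.prems by (simp add: subspace_scale)
    from umin[OF this] have "c \<le> (x \<bullet> (A *v x)) / (x \<bullet> x)"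
      by (simp add: c_def matrix_vector_mult_scaleR dot_square_norm power2_eq_square field_simps)
    then show ?thesis using False by (simp add: field_simps)
  qed simp
  have eig: "x \<bullet> (A *v u) = c * (x \<bullet> u)" if "x \<in> V" for x
    by (rule psd_null_vector[OF sym Suc.prems q uV _ that]) (simp_all add: c_def uu)
  let ?W = "{x \<in> V. orthogonal u x}"
  have subW: "subspace ?W"
    using Suc.prems by (auto simp: subspace_def orthogonal_def inner_add_right)
  have "dim ?W + dim (span {u}) = dim V"
  proof -
    have "dim {y \<in> V. \<forall>x\<in>span {u}. orthogonal x y} + dim (span {u}) = dim V"
      using dim_subspace_orthogonal_to_vectors[OF subspace_span[of "{u}"] Suc.prems] uV Suc.prems
      by (metis empty_subsetI insert_subset span_minimal)
    moreover have "{y \<in> V. \<forall>x\<in>span {u}. orthogonal x y} = ?W"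
      by (auto simp: span_singleton orthogonal_def)
    ultimately show ?thesis by simp
  qed
  moreover have "dim (span {u}) = 1"
    using uu by (simp add: dim_span) (metis inner_zero_left zero_neq_one dim_singleton)
  ultimately have dW: "n = dim ?W" using Suc(2) by simp
  from Suc(1)[OF dW subW] obtain v l where vl: "spectral_system A ?W n v l" using dW by auto
  define v' where "v' i = (case i of 0 \<Rightarrow> u | Suc j \<Rightarrow> v j)" for i
  define l' where "l' i = (case i of 0 \<Rightarrow> c | Suc j \<Rightarrow> l j)" for i
  have vW: "v i \<in> V" "u \<bullet> v i = 0" if "i < n" for i
    using vl that by (auto simp: spectral_system_def orthogonal_def)
  have v1: "v i \<bullet> v j = (if i = j then 1 else 0)" if "i < n" "j < n" for i j
    using vl that by (auto simp: spectral_system_def)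
  have cl: "c \<le> l i" if "i < n" for i
  proof -
    have "v i \<bullet> (A *v v i) = l i * (v i \<bullet> v i)"
      using vl that unfolding spectral_system_def by blast
    then show ?thesis using q[OF vW(1)[OF that]] v1[OF that that] by simp
  qed
  have decomp: "x - (x \<bullet> u) *\<^sub>R u \<in> ?W" if "x \<in> V" for x
    using that uV Suc.prems uu
    by (auto simp: orthogonal_def inner_diff_right inner_commute subspace_diff subspace_scale)
  have "spectral_system A V (Suc n) v' l'"
    unfolding spectral_system_def
  proof (intro conjI ballI allI impI)
    fix i assume "i < Suc n" then show "v' i \<in> V"
      using uV vW by (auto simp: v'_def split: nat.split)
  next
    fix i j assume "i < Suc n" "j < Suc n"
    then show "v' i \<bullet> v' j = (if i = j then 1 else 0)"
      using uu vW v1 by (auto simp: v'_def inner_commute split: nat.split)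
  next
    fix x assume x: "x \<in> V"
    let ?y = "x - (x \<bullet> u) *\<^sub>R u"
    have "?y = (\<Sum>i<n. (?y \<bullet> v i) *\<^sub>R v i)"
      using vl decomp[OF x] unfolding spectral_system_def by blast
    also have "\<dots> = (\<Sum>i<n. (x \<bullet> v i) *\<^sub>R v i)"
      by (rule sum.cong) (auto simp: inner_diff_left vW)
    finally show "x = (\<Sum>i<Suc n. (x \<bullet> v' i) *\<^sub>R v' i)"
      unfolding sum.lessThan_Suc_shift by (simp add: v'_def algebra_simps)
  next
    fix i x assume i: "i < Suc n" and x: "x \<in> V"
    show "x \<bullet> (A *v v' i) = l' i * (x \<bullet> v' i)"
    proof (cases i)
      case 0 then show ?thesis using eig[OF x] by (simp add: v'_def l'_def)
    next
      case (Suc j)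
      then have j: "j < n" using i by simp
      have "(x - (x \<bullet> u) *\<^sub>R u) \<bullet> (A *v v j) = l j * ((x - (x \<bullet> u) *\<^sub>R u) \<bullet> v j)"
        using vl decomp[OF x] j unfolding spectral_system_def by blast
      moreover have "u \<bullet> (A *v v j) = 0"
        using symmetric_dot[OF sym, of u "v j"] eig[OF vW(1)[OF j]] vW(2)[OF j]
        by (simp add: inner_commute)
      ultimately show ?thesis using Suc vW(2)[OF j]
        by (simp add: v'_def l'_def inner_diff_left)
    qed
  next
    fix i j :: nat assume "i \<le> j" "j < Suc n"
    then show "l' i \<le> l' j"
      using cl vl by (auto simp: l'_def spectral_system_def split: nat.split)
  qed
  then show ?case using Suc(2) by metis
qed

context
  fixes A :: "real^'n^'n" and V n v l
  assumes sys: "spectral_system A V n v l"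
begin

lemma spectral_system_mem: "i < n \<Longrightarrow> v i \<in> V"
  and spectral_system_orthonormal: "i < n \<Longrightarrow> j < n \<Longrightarrow> v i \<bullet> v j = (if i = j then 1 else 0)"
  and spectral_system_expand: "x \<in> V \<Longrightarrow> x = (\<Sum>i<n. (x \<bullet> v i) *\<^sub>R v i)"
  and spectral_system_eigen: "i < n \<Longrightarrow> x \<in> V \<Longrightarrow> x \<bullet> (A *v v i) = l i * (x \<bullet> v i)"
  and spectral_system_sorted: "i \<le> j \<Longrightarrow> j < n \<Longrightarrow> l i \<le> l j"
  using sys unfolding spectral_system_def by blast+

lemma spectral_system_norm: "x \<in> V \<Longrightarrow> x \<bullet> x = (\<Sum>i<n. (x \<bullet> v i)\<^sup>2)"
proof -
  assume x: "x \<in> V"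
  have "x \<bullet> x = x \<bullet> (\<Sum>i<n. (x \<bullet> v i) *\<^sub>R v i)" using spectral_system_expand[OF x] by simp
  then show ?thesis by (simp add: inner_sum_right power2_eq_square)
qed

lemma spectral_system_dot: "x \<in> V \<Longrightarrow> y \<in> V \<Longrightarrow> x \<bullet> (A *v y) = (\<Sum>i<n. l i * (x \<bullet> v i) * (y \<bullet> v i))"
proof -
  assume x: "x \<in> V" and y: "y \<in> V"
  have "x \<bullet> (A *v y) = x \<bullet> (A *v (\<Sum>i<n. (y \<bullet> v i) *\<^sub>R v i))"
    using spectral_system_expand[OF y] by simp
  also have "\<dots> = (\<Sum>i<n. (y \<bullet> v i) * (x \<bullet> (A *v v i)))"
    by (simp add: matrix_vector_right_distrib linear_sum[OF matrix_vector_mul_linear] inner_sum_right matrix_vector_mult_scaleR)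
  also have "\<dots> = (\<Sum>i<n. l i * (x \<bullet> v i) * (y \<bullet> v i))"
    by (rule sum.cong) (simp_all add: spectral_system_eigen[OF _ x])
  finally show ?thesis .
qed

lemma spectral_system_dim_span:
  assumes "I \<subseteq> {..<n}"
  shows "dim (span (v ` I)) = card I"
proof -
  have inj: "inj_on v I"
  proof (rule inj_onI)
    fix i j assume ij: "i \<in> I" "j \<in> I" "v i = v j"
    then have "i < n" "j < n" using assms by auto
    then show "i = j"
      using ij(3) spectral_system_orthonormal[of i i] spectral_system_orthonormal[of i j]
      by (auto split: if_splits)
  qed
  have "0 \<notin> v ` I" using assms spectral_system_orthonormal by (force)
  moreover have "pairwise orthogonal (v ` I)"
    using assms spectral_system_orthonormal by (auto simp: pairwise_def orthogonal_def) (metis lessThan_iff subsetD)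
  ultimately have "independent (v ` I)" by (rule pairwise_orthogonal_independent[rotated])
  then show ?thesis
    using dim_span_eq_card_independent card_image[OF inj] by metis
qed

lemma spectral_system_span_dot:
  assumes "I \<subseteq> {..<n}" "x \<in> span (v ` I)" "i < n" "i \<notin> I"
  shows "x \<bullet> v i = 0"
proof -
  have "orthogonal (v i) x"
    by (rule orthogonal_to_span[OF assms(2)]) (use assms(1,3,4) spectral_system_orthonormal in \<open>force simp: orthogonal_def\<close>)
  then show ?thesis by (simp add: orthogonal_def inner_commute)
qed

end

text \<open>Courant-Fischer dimension count: the \<open>v\<close> up to index \<open>Suc j\<close>
  span \<open>j + 2\<close> dimensions and the \<open>w\<close> from \<open>j\<close> on span
  \<open>n - j\<close>, all inside dimension \<open>n + 1\<close>, so some nonzero \<open>x\<close>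
  lies in both spans. Its quadratic form is at least \<open>\<mu> j\<close> and at most
  \<open>l (Suc j)\<close> times \<open>x \<bullet> x\<close>.\<close>

lemma eigenvalue_interlacing:
  fixes A :: "real^'n^'n"
  assumes V: "spectral_system A V (Suc n) v l" "subspace V" "dim V = Suc n"
    and W: "spectral_system A W n w \<mu>" "subspace W" "W \<subseteq> V"
    and j: "j < n"
  shows "\<mu> j \<le> l (Suc j)"
proof -
  let ?X = "span (v ` {..Suc j})" and ?Y = "span (w ` {j..<n})"
  have "v ` {..Suc j} \<subseteq> V" using spectral_system_mem[OF V(1)] j by auto
  then have XV: "?X \<subseteq> V" using V(2) span_minimal by blast
  have "w ` {j..<n} \<subseteq> W" using spectral_system_mem[OF W(1)] by auto
  then have YW: "?Y \<subseteq> W" using W(2) span_minimal by blast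
  have "dim ?X = Suc (Suc j)"
    by (subst spectral_system_dim_span[OF V(1)]) (use j in auto)
  moreover have "dim ?Y = n - j"
    by (subst spectral_system_dim_span[OF W(1)]) auto
  moreover have "dim {x + y |x y. x \<in> ?X \<and> y \<in> ?Y} \<le> dim V"
    by (rule dim_subset) (use XV YW W(3) V(2) in \<open>auto simp: subspace_add subset_iff\<close>)
  moreover have "dim {x + y |x y. x \<in> ?X \<and> y \<in> ?Y} + dim (?X \<inter> ?Y) = dim ?X + dim ?Y"
    by (rule dim_sums_Int) auto
  ultimately have "dim (?X \<inter> ?Y) > 0" using V(3) j by linarith
  then have "\<not> ?X \<inter> ?Y \<subseteq> {0}" by (metis dim_eq_0 less_irrefl)
  then obtain x where x: "x \<in> ?X" "x \<in> ?Y" "x \<noteq> 0" by auto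
  have xV: "x \<in> V" and xW: "x \<in> W" using x XV YW by auto
  have "\<mu> j * (x \<bullet> x) = (\<Sum>i<n. \<mu> j * (x \<bullet> w i)\<^sup>2)"
    unfolding spectral_system_norm[OF W(1) xW] sum_distrib_left ..
  also have "\<dots> \<le> (\<Sum>i<n. \<mu> i * (x \<bullet> w i) * (x \<bullet> w i))"
  proof (rule sum_mono)
    fix i assume i: "i \<in> {..<n}"
    show "\<mu> j * (x \<bullet> w i)\<^sup>2 \<le> \<mu> i * (x \<bullet> w i) * (x \<bullet> w i)"
    proof (cases "j \<le> i")
      case True
      then have "\<mu> j \<le> \<mu> i" using spectral_system_sorted[OF W(1)] i by auto
      then have "\<mu> j * (x \<bullet> w i)\<^sup>2 \<le> \<mu> i * (x \<bullet> w i)\<^sup>2" by (simp add: mult_right_mono)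
      then show ?thesis by (simp add: power2_eq_square)
    next
      case False
      then have "x \<bullet> w i = 0"
        by (intro spectral_system_span_dot[OF W(1) _ x(2)]) (use i in auto)
      then show ?thesis by simp
    qed
  qed
  also have "\<dots> = (\<Sum>i<Suc n. l i * (x \<bullet> v i) * (x \<bullet> v i))"
    using spectral_system_dot[OF V(1) xV xV] spectral_system_dot[OF W(1) xW xW] by simp
  also have "\<dots> \<le> (\<Sum>i<Suc n. l (Suc j) * (x \<bullet> v i)\<^sup>2)"
  proof (rule sum_mono)
    fix i assume i: "i \<in> {..<Suc n}"
    show "l i * (x \<bullet> v i) * (x \<bullet> v i) \<le> l (Suc j) * (x \<bullet> v i)\<^sup>2"
    proof (cases "i \<le> Suc j")
      case True
      then have "l i \<le> l (Suc j)" using spectral_system_sorted[OF V(1)] j by auto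
      then have "l i * (x \<bullet> v i)\<^sup>2 \<le> l (Suc j) * (x \<bullet> v i)\<^sup>2" by (simp add: mult_right_mono)
      then show ?thesis by (simp add: power2_eq_square)
    next
      case False
      then have "x \<bullet> v i = 0"
        by (intro spectral_system_span_dot[OF V(1) _ x(1)]) (use i j in auto)
      then show ?thesis by simp
    qed
  qed
  also have "\<dots> = l (Suc j) * (x \<bullet> x)"
    unfolding spectral_system_norm[OF V(1) xV] sum_distrib_left ..
  finally show ?thesis using x(3) by simp
qed

section \<open>Elimination of one coordinate from the resolvent\<close>

definition coord_space :: "'n set \<Rightarrow> (real^'n) set" where
  "coord_space S = {x. \<forall>i. i \<notin> S \<longrightarrow> x $ i = 0}"

lemma subspace_coord_space: "subspace (coord_space S)"
  by (auto simp: coord_space_def subspace_def)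

lemma dim_coord_space: "dim (coord_space S :: (real^'n) set) = card S"
  using dim_substandard_cart[where 'a = real, of S] unfolding coord_space_def dim_vec_eq .

lemma axis_in_coord_space: "i \<in> S \<Longrightarrow> axis i 1 \<in> coord_space S"
  by (auto simp: coord_space_def axis_def)

lemma axis_dot: "axis i 1 \<bullet> (x :: real^'n) = x $ i"
  by (simp add: inner_axis')

text \<open>Padding with the identity outside \<open>S\<close> keeps the index type fixed; the determinant is the
  characteristic polynomial of the principal submatrix on \<open>S\<close>.\<close>

definition shifted_compression :: "real^'n^'n \<Rightarrow> 'n set \<Rightarrow> real \<Rightarrow> real^'n^'n" where
  "shifted_compression A S z =
     (\<chi> i j. if i \<in> S \<and> j \<in> S then (if i = j then z else 0) - A $ i $ j else if i = j then 1 else 0)"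

lemma shifted_compression_in:
  fixes A :: "real^'n^'n"
  assumes "x \<in> coord_space S" "i \<in> S"
  shows "(shifted_compression A S z *v x) $ i = z * x $ i - (A *v x) $ i"
proof -
  have "(shifted_compression A S z *v x) $ i =
    (\<Sum>j\<in>UNIV. (if i = j then z * x $ j else 0) - A $ i $ j * x $ j)"
    unfolding matrix_vector_mult_def shifted_compression_def
    using assms by (auto simp: coord_space_def intro!: sum.cong simp: algebra_simps)
  then show ?thesis by (simp add: sum_subtractf matrix_vector_mult_def)
qed

lemma shifted_compression_out:
  fixes A :: "real^'n^'n"
  assumes "i \<notin> S"
  shows "(shifted_compression A S z *v x) $ i = x $ i"
proof -
  have "(shifted_compression A S z *v x) $ i = (\<Sum>j\<in>UNIV. if i = j then x $ j else 0)"
    unfolding matrix_vector_mult_def shifted_compression_def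
    using assms by (simp add: if_distrib[of "\<lambda>c. c * _"] cong: if_cong)
  then show ?thesis by simp
qed

text \<open>The eigenvectors on \<open>S\<close>, completed by unit vectors off \<open>S\<close>,
  form an orthogonal matrix \<open>P\<close> that diagonalises the padded matrix.\<close>

lemma det_shifted_compression:
  fixes A :: "real^'n^'n"
  assumes sys: "spectral_system A (coord_space S) (card S) v l"
  shows "det (shifted_compression A S z) = (\<Prod>h<card S. z - l h)"
proof -
  obtain f where f: "bij_betw f S {..<card S}"
    using ex_bij_betw_finite_nat[of S] by (auto simp: atLeast0LessThan)
  define c where "c j = (if j \<in> S then v (f j) else axis j 1)" for j
  define d where "d j = (if j \<in> S then z - l (f j) else 1)" for j
  define P where "P = (\<chi> i j. c j $ i)"
  define D where "D = (\<chi> i j. if i = j then d j else 0)"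
  have fS: "f j < card S" if "j \<in> S" for j using f that by (auto simp: bij_betw_def)
  have cS: "c j \<in> coord_space S" if "j \<in> S" for j
    using spectral_system_mem[OF sys fS[OF that]] that by (simp add: c_def)
  have Mc: "(shifted_compression A S z *v c j) $ i = d j * c j $ i" for i j
  proof (cases "j \<in> S")
    case True
    show ?thesis
    proof (cases "i \<in> S")
      case i: True
      have "(A *v v (f j)) $ i = l (f j) * v (f j) $ i"
        using spectral_system_eigen[OF sys fS[OF True] axis_in_coord_space[OF i]]
        by (simp add: axis_dot)
      then show ?thesis
        unfolding shifted_compression_in[OF cS[OF True] i] using True
        by (simp add: c_def d_def algebra_simps)
    next
      case False
      then show ?thesis using cS[OF True] by (simp add: shifted_compression_out coord_space_def)
    qed
  next
    case False
    then show ?thesis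
      by (auto simp: c_def d_def matrix_vector_mul_component shifted_compression_def axis_def
          inner_vec_def if_distrib cong: if_cong)
  qed
  have "shifted_compression A S z ** P = P ** D"
  proof -
    have "(shifted_compression A S z ** P) $ i $ j = (P ** D) $ i $ j" for i j
    proof -
      have "(shifted_compression A S z ** P) $ i $ j = (shifted_compression A S z *v c j) $ i"
        by (simp add: matrix_matrix_mult_def matrix_vector_mult_def P_def)
      also have "\<dots> = (P ** D) $ i $ j"
        unfolding Mc by (simp add: matrix_matrix_mult_def P_def D_def if_distrib cong: if_cong)
      finally show ?thesis .
    qed
    then show ?thesis by (simp add: vec_eq_iff)
  qed
  then have "det (shifted_compression A S z) * det P = det P * det D" by (metis det_mul)
  moreover have "det P \<noteq> 0"
  proof -
    have cc: "c i \<bullet> c j = (if i = j then 1 else 0)" for i j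
    proof (cases "i \<in> S")
      case True
      show ?thesis
      proof (cases "j \<in> S")
        case j: True
        have "f i = f j \<longleftrightarrow> i = j" using f True j by (auto simp: bij_betw_def inj_on_def)
        then show ?thesis using spectral_system_orthonormal[OF sys fS[OF True] fS[OF j]] True j
          by (simp add: c_def)
      next
        case False
        then have "c i \<bullet> c j = c i $ j" by (simp add: c_def inner_axis)
        then show ?thesis using cS[OF True] False True by (auto simp: coord_space_def)
      qed
    next
      case False
      then have "c i \<bullet> c j = c j $ i" by (simp add: c_def axis_dot)
      then show ?thesis using cS[of j] False by (auto simp: coord_space_def c_def axis_def)
    qed
    have "transpose P ** P = mat 1"
      using cc by (simp add: vec_eq_iff matrix_matrix_mult_def transpose_def P_def mat_def
          inner_vec_def mult.commute)
    then have "det P * det P = 1" by (metis det_I det_mul det_transpose)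
    then show ?thesis by auto
  qed
  moreover have "det D = (\<Prod>h<card S. z - l h)"
  proof -
    have "det D = (\<Prod>j\<in>UNIV. d j)"
      using det_diagonal[of D] by (simp add: D_def)
    also have "\<dots> = (\<Prod>j\<in>S. z - l (f j))"
      unfolding d_def by (simp add: prod.If_cases)
    also have "\<dots> = (\<Prod>h<card S. z - l h)"
      by (rule prod.reindex_bij_betw[OF f])
    finally show ?thesis .
  qed
  ultimately show ?thesis by simp
qed

text \<open>The numerator in Cramer's rule for the diagonal entry of the inverse at
  \<open>e\<close>. Column operations clear the rest of row \<open>e\<close>; they are encoded as
  right multiplication by \<open>L\<close>, which has determinant 1.\<close>

lemma det_shifted_compression_column:
  fixes A :: "real^'n^'n"
  assumes "e \<notin> S"
  shows "det (\<chi> i j. if j = e then axis e 1 $ i else shifted_compression A (insert e S) z $ i $ j) =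
    det (shifted_compression A S z)"
  (is "det ?X = det ?M")
proof -
  define r :: "real^'n" where "r = (\<chi> j. if j \<in> S then - A $ e $ j else 0)"
  define L :: "real^'n^'n" where "L = (\<chi> k. if k = e then row e (mat 1) + r else row k (mat 1))"
  have X: "?X = ?M ** L"
  proof -
    have "?X $ i $ j = (?M ** L) $ i $ j" for i j
    proof -
      have "(?M ** L) $ i $ j = (\<Sum>k\<in>UNIV. ?M $ i $ k * ((if k = j then 1 else 0) + (if k = e then r $ j else 0)))"
        by (auto simp: matrix_matrix_mult_def L_def row_def mat_def intro!: sum.cong)
      also have "\<dots> = ?M $ i $ j + ?M $ i $ e * r $ j"
        by (simp add: distrib_left sum.distrib if_distrib[of "\<lambda>c. _ * c"] cong: if_cong)
      also have "\<dots> = ?X $ i $ j"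
        using assms by (auto simp: shifted_compression_def r_def axis_def)
      finally show ?thesis by simp
    qed
    then show ?thesis by (simp add: vec_eq_iff)
  qed
  have "det L = det (mat 1 :: real^'n^'n)"
    unfolding L_def
  proof (rule det_row_span)
    have "r = (\<Sum>j\<in>S. r $ j *s axis j 1)"
      by (auto simp: vec_eq_iff r_def axis_def if_distrib cong: if_cong)
    moreover have "axis j 1 \<in> {row j (mat 1 :: real^'n^'n) |j. j \<noteq> e}" if "j \<in> S" for j :: 'n
    proof -
      have "axis j 1 = row j (mat 1 :: real^'n^'n)" by (auto simp: row_def mat_def axis_def vec_eq_iff)
      then show ?thesis using that assms by blast
    qed
    then have "(\<Sum>j\<in>S. r $ j *s axis j 1) \<in> vec.span {row j (mat 1) |j. j \<noteq> e}"
      by (intro vec.span_sum vec.span_scale vec.span_base)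
    ultimately show "r \<in> vec.span {row j (mat 1) |j. j \<noteq> e}" by simp
  qed
  then show ?thesis using X by (simp add: det_mul)
qed

section \<open>The resolvent column at a coordinate and its elimination\<close>

context
  fixes A :: "real^'n^'n" and S e v l w \<mu> n
  assumes sym: "transpose A = A" and eS: "e \<notin> S" and n: "n = card S"
    and T: "spectral_system A (coord_space (insert e S)) (Suc n) v l"
    and S: "spectral_system A (coord_space S) n w \<mu>"
begin

text \<open>\<open>y\<close> is column \<open>e\<close> of the resolvent, expanded in the
  eigenbasis. The resolvent equation is stated in weak form, tested against the coordinate space,
  because only the compression of \<open>A\<close> is diagonalised.\<close>

lemma resolvent_column_solves:
  assumes z: "\<And>m. m \<le> n \<Longrightarrow> z \<noteq> l m"
  defines "y \<equiv> (\<Sum>m<Suc n. (v m $ e / (z - l m)) *\<^sub>R v m)"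
  shows "y \<in> coord_space (insert e S)"
    and "x \<in> coord_space (insert e S) \<Longrightarrow> z * (x \<bullet> y) - x \<bullet> (A *v y) = x $ e"
proof -
  show "y \<in> coord_space (insert e S)"
    unfolding y_def
    by (intro subspace_sum subspace_coord_space subspace_scale spectral_system_mem[OF T]) auto
  assume x: "x \<in> coord_space (insert e S)"
  have "x \<bullet> (A *v y) = (\<Sum>m<Suc n. (v m $ e / (z - l m)) * (x \<bullet> (A *v v m)))"
    unfolding y_def
    by (simp only: linear_sum[OF matrix_vector_mul_linear] inner_sum_right
        matrix_vector_mult_scaleR inner_scaleR_right)
  also have "\<dots> = (\<Sum>m<Suc n. (v m $ e / (z - l m)) * (l m * (x \<bullet> v m)))"
    by (rule sum.cong) (simp_all add: spectral_system_eigen[OF T _ x])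
  finally have "z * (x \<bullet> y) - x \<bullet> (A *v y) =
      (\<Sum>m<Suc n. z * ((v m $ e / (z - l m)) * (x \<bullet> v m)) - (v m $ e / (z - l m)) * (l m * (x \<bullet> v m)))"
    by (simp only: y_def inner_sum_right sum_distrib_left sum_subtractf inner_scaleR_right)
  also have "\<dots> = (\<Sum>m<Suc n. (x \<bullet> v m) * v m $ e)"
  proof (rule sum.cong)
    fix m assume "m \<in> {..<Suc n}"
    then have nz: "z - l m \<noteq> 0" using z[of m] by auto
    have "z * ((v m $ e / (z - l m)) * (x \<bullet> v m)) - (v m $ e / (z - l m)) * (l m * (x \<bullet> v m)) =
      (z - l m) * (v m $ e / (z - l m)) * (x \<bullet> v m)"
      by (simp only: left_diff_distrib right_diff_distrib mult_ac)
    then show "z * ((v m $ e / (z - l m)) * (x \<bullet> v m)) - (v m $ e / (z - l m)) * (l m * (x \<bullet> v m)) =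
      (x \<bullet> v m) * v m $ e" using nz by simp
  qed simp
  also have "\<dots> = (\<Sum>m<Suc n. (x \<bullet> v m) *\<^sub>R v m) $ e" by simp
  also have "\<dots> = x $ e" using spectral_system_expand[OF T x] by simp
  finally show "z * (x \<bullet> y) - x \<bullet> (A *v y) = x $ e" .
qed

text \<open>Block elimination of the coordinate \<open>e\<close>: by Cramer's rule the \<open>e\<close>-entry of the column
  \<open>e\<close> of the resolvent of the larger compression is the quotient of the two characteristic
  polynomials, and the remaining entries solve an equation for the smaller resolvent.\<close>

lemma resolvent_column_eliminate:
  assumes z: "\<And>m. m \<le> n \<Longrightarrow> z \<noteq> l m" and z': "\<And>m. m < n \<Longrightarrow> z \<noteq> \<mu> m" and i: "i \<in> S"
  shows "(\<Prod>h<Suc n. z - l h) * (\<Sum>m<Suc n. v m $ e * v m $ i / (z - l m)) =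
    (\<Prod>h<n. z - \<mu> h) * (\<Sum>s\<in>S. A $ s $ e * (\<Sum>m<n. w m $ s * w m $ i / (z - \<mu> m)))"
proof -
  let ?T = "insert e S"
  define y where "y = (\<Sum>m<Suc n. (v m $ e / (z - l m)) *\<^sub>R v m)"
  have y: "y \<in> coord_space ?T"
    "\<And>x. x \<in> coord_space ?T \<Longrightarrow> z * (x \<bullet> y) - x \<bullet> (A *v y) = x $ e"
    unfolding y_def using resolvent_column_solves[of z] z by blast+
  have cT: "card ?T = Suc n" using eS n by simp
  have detT: "det (shifted_compression A ?T z) = (\<Prod>h<Suc n. z - l h)"
    using det_shifted_compression[of A ?T v l z] T cT by simp
  then have detT0: "det (shifted_compression A ?T z) \<noteq> 0" using z by (auto simp: less_Suc_eq_le)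
  have "shifted_compression A ?T z *v y = axis e 1"
  proof -
    have "(shifted_compression A ?T z *v y) $ k = axis e 1 $ k" for k
    proof (cases "k \<in> ?T")
      case True
      have "z * (axis k 1 \<bullet> y) - axis k 1 \<bullet> (A *v y) = axis k 1 $ e"
        by (rule y(2)[OF axis_in_coord_space[OF True]])
      then have "z * y $ k - (A *v y) $ k = axis k 1 $ e" by (simp only: axis_dot)
      then show ?thesis
        using shifted_compression_in[OF y(1) True, of A z] by (auto simp: axis_def)
    next
      case False
      then show ?thesis using shifted_compression_out[OF False, of A z y] y(1) z
        by (auto simp: coord_space_def axis_def)
    qed
    then show ?thesis by (simp add: vec_eq_iff)
  qed
  then have "y $ e = det (shifted_compression A S z) / det (shifted_compression A ?T z)"
    unfolding cramer[OF detT0] using det_shifted_compression_column[OF eS, of A z] by simp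
  then have ye: "(\<Prod>h<Suc n. z - l h) * y $ e = (\<Prod>h<n. z - \<mu> h)"
    using detT detT0 det_shifted_compression[of A S w \<mu> z] S n by simp
  \<comment> \<open>Dropping the entry at \<open>e\<close> leaves a vector supported on
    \<open>S\<close>, which the smaller eigenbasis expands.\<close>
  define x where "x = y - y $ e *\<^sub>R axis e 1"
  have xS: "x \<in> coord_space S"
    using y(1) by (auto simp: x_def coord_space_def axis_def)
  \<comment> \<open>Testing with \<open>w m\<close>, which vanishes at \<open>e\<close>, turns the
    coupling through column \<open>e\<close> of \<open>A\<close> into a right-hand side for the
    smaller resolvent.\<close>
  have dot: "(w m \<bullet> x) * (z - \<mu> m) = y $ e * (\<Sum>s\<in>S. w m $ s * A $ s $ e)" if m: "m < n" for m
  proof -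
    have wS: "w m \<in> coord_space S" by (rule spectral_system_mem[OF S m])
    then have wT: "w m \<in> coord_space ?T" by (auto simp: coord_space_def)
    have we: "w m $ e = 0" using wS eS by (auto simp: coord_space_def)
    have "z * (w m \<bullet> y) - w m \<bullet> (A *v y) = 0"
      using y(2)[OF wT] we by simp
    moreover have yx: "y = x + y $ e *\<^sub>R axis e 1" by (simp add: x_def)
    moreover have "w m \<bullet> y = w m \<bullet> x"
      by (subst yx) (simp add: inner_add_right inner_axis we)
    moreover have "w m \<bullet> (A *v y) = w m \<bullet> (A *v x) + y $ e * (w m \<bullet> (A *v axis e 1))"
      by (subst yx) (simp add: matrix_vector_right_distrib matrix_vector_mult_scaleR inner_add_right)
    moreover have "w m \<bullet> (A *v x) = \<mu> m * (w m \<bullet> x)"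
      using spectral_system_eigen[OF S m xS] symmetric_dot[OF sym, of x "w m"]
      by (simp add: inner_commute)
    moreover have "w m \<bullet> (A *v axis e 1) = (\<Sum>s\<in>S. w m $ s * A $ s $ e)"
    proof -
      have "w m \<bullet> (A *v axis e 1) = (\<Sum>s\<in>UNIV. w m $ s * A $ s $ e)"
        by (simp add: inner_vec_def matrix_vector_mult_basis column_def)
      also have "\<dots> = (\<Sum>s\<in>S. w m $ s * A $ s $ e)"
        by (rule sum.mono_neutral_right) (use wS in \<open>auto simp: coord_space_def\<close>)
      finally show ?thesis .
    qed
    ultimately show ?thesis by (simp add: algebra_simps)
  qed
  have "(\<Sum>m<Suc n. v m $ e * v m $ i / (z - l m)) = y $ i"
    by (simp add: y_def)
  also have "\<dots> = x $ i" using i eS by (auto simp: x_def axis_def)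
  also have "\<dots> = (\<Sum>m<n. (x \<bullet> w m) *\<^sub>R w m) $ i" using spectral_system_expand[OF S xS] by simp
  also have "\<dots> = (\<Sum>m<n. y $ e * (\<Sum>s\<in>S. A $ s $ e * (w m $ s * w m $ i / (z - \<mu> m))))"
    unfolding sum_component
  proof (rule sum.cong)
    fix m assume "m \<in> {..<n}"
    then have m: "m < n" and nz: "z - \<mu> m \<noteq> 0" using z' by auto
    have "x \<bullet> w m = y $ e * (\<Sum>s\<in>S. w m $ s * A $ s $ e) / (z - \<mu> m)"
      using dot[OF m] nz by (simp add: inner_commute field_simps)
    then show "((x \<bullet> w m) *\<^sub>R w m) $ i = y $ e * (\<Sum>s\<in>S. A $ s $ e * (w m $ s * w m $ i / (z - \<mu> m)))"
      by (simp add: sum_distrib_left sum_distrib_right sum_divide_distrib mult_ac)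
  qed simp
  also have "\<dots> = y $ e * (\<Sum>s\<in>S. A $ s $ e * (\<Sum>m<n. w m $ s * w m $ i / (z - \<mu> m)))"
    unfolding sum_distrib_left by (rule sum.swap)
  finally show ?thesis unfolding ye[symmetric] by (simp only: mult.assoc)
qed

end

section \<open>Newton products with entrywise nonnegative values\<close>

text \<open>Writing \<open>z - x\<close> as \<open>(z - l k) - (x - l k)\<close> turns each summand
  into a difference of consecutive mixed products.\<close>

lemma newton_telescope:
  fixes l :: "nat \<Rightarrow> real"
  assumes "K \<le> n"
  shows "(\<Sum>k<K. (\<Prod>h<k. x - l h) * (z - x) * (\<Prod>h=Suc k..<n. z - l h)) =
    (\<Prod>h=0..<n. z - l h) - (\<Prod>h<K. x - l h) * (\<Prod>h=K..<n. z - l h)"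
  using assms
proof (induction K)
  case (Suc K)
  then have eq: "(\<Prod>h=K..<n. z - l h) = (z - l K) * (\<Prod>h=Suc K..<n. z - l h)"
    by (simp add: prod.atLeast_Suc_lessThan)
  have IH: "(\<Sum>k<K. (\<Prod>h<k. x - l h) * (z - x) * (\<Prod>h=Suc k..<n. z - l h)) =
    (\<Prod>h=0..<n. z - l h) - (\<Prod>h<K. x - l h) * ((z - l K) * (\<Prod>h=Suc K..<n. z - l h))"
    using Suc unfolding eq[symmetric] by simp
  show ?case unfolding sum.lessThan_Suc prod.lessThan_Suc IH by (simp add: algebra_simps)
qed simp

text \<open>At \<open>x = l m\<close> the last term of the telescope has a zero factor. Summed over
  the eigenbasis, this expands the adjugate with Newton products as coefficients.\<close>

lemma newton_resolvent:
  fixes l :: "nat \<Rightarrow> real"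
  assumes "m < n" "z \<noteq> l m"
  shows "(\<Prod>h<n. z - l h) / (z - l m) = (\<Sum>k<n. (\<Prod>h<k. l m - l h) * (\<Prod>h=Suc k..<n. z - l h))"
proof -
  have "(\<Prod>h<n. l m - l h) = 0" using assms(1) by auto
  then have "(z - l m) * (\<Sum>k<n. (\<Prod>h<k. l m - l h) * (\<Prod>h=Suc k..<n. z - l h)) = (\<Prod>h<n. z - l h)"
    using newton_telescope[of n n "l m" l z]
    by (simp add: sum_distrib_left mult_ac atLeast0LessThan)
  then show ?thesis using assms(2) by (simp add: field_simps)
qed

text \<open>The polynomials have distinct degrees \<open>n - 1 - k\<close>. Vanishing beyond a
  threshold \<open>Z\<close> suffices, as a nonzero polynomial has finitely many roots; this lets
  \<open>z\<close> avoid the eigenvalues.\<close>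

lemma newton_basis_independent:
  fixes l a :: "nat \<Rightarrow> real"
  assumes "\<And>z. z > Z \<Longrightarrow> (\<Sum>k<n. a k * (\<Prod>h=Suc k..<n. z - l h)) = 0" and "k < n"
  shows "a k = 0"
proof -
  define P where "P n = (\<Sum>k<n. smult (a k) (\<Prod>h=Suc k..<n. [:- l h, 1:]))" for n
  have poly_P: "poly (P n) z = (\<Sum>k<n. a k * (\<Prod>h=Suc k..<n. z - l h))" for n z
    by (simp add: P_def poly_sum poly_prod)
  have "P n = 0"
  proof (rule ccontr)
    assume "P n \<noteq> 0"
    then have "finite {z. poly (P n) z = 0}" by (rule poly_roots_finite)
    moreover have "{Z<..} \<subseteq> {z. poly (P n) z = 0}" using assms(1) by (auto simp: poly_P)
    ultimately show False using infinite_Ioi[of Z] finite_subset by blast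
  qed
  moreover have "\<forall>k<n. a k = 0" if "P n = 0"
    using that
  proof (induction n)
    case (Suc n)
    \<comment> \<open>All basis polynomials but the last contain the factor for \<open>l n\<close>,
      so evaluation at \<open>l n\<close> isolates \<open>a n\<close>.\<close>
    have "P (Suc n) = [:a n:] + [:- l n, 1:] * P n"
      by (simp add: P_def sum_distrib_left mult.commute)
    then have eq: "[:a n:] + [:- l n, 1:] * P n = 0" using Suc.prems by simp
    then have "poly ([:a n:] + [:- l n, 1:] * P n) (l n) = 0" by simp
    then have an: "a n = 0" by simp
    then have "[:- l n, 1:] * P n = 0" using eq by (simp only: pCons_0_0 add_0)
    then have "P n = 0" by (metis mult_eq_0_iff pCons_eq_0_iff one_neq_zero)
    then show ?case using Suc.IH an less_Suc_eq by auto
  qed simp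
  ultimately show ?thesis using assms(2) by simp
qed

text \<open>Interlacing enters here: it makes the characteristic polynomial factors of the smaller
  matrix nonnegative combinations of those of the larger one.\<close>

lemma newton_basis_interlacing:
  fixes l \<mu> :: "nat \<Rightarrow> real"
  assumes l: "\<And>i j. i \<le> j \<Longrightarrow> j \<le> n \<Longrightarrow> l i \<le> l j"
    and il: "\<And>j. j < n \<Longrightarrow> \<mu> j \<le> l (Suc j)" and "j \<le> n"
  shows "\<exists>c. (\<forall>k\<le>n. 0 \<le> c k) \<and> (\<forall>k<j. c k = 0) \<and>
    (\<forall>z. (\<Prod>h=j..<n. z - \<mu> h) = (\<Sum>k<Suc n. c k * (\<Prod>h=Suc k..<Suc n. z - l h)))"
  using \<open>j \<le> n\<close>
proof (induction rule: inc_induct)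
  case base
  show ?case by (rule exI[of _ "\<lambda>k. if k = n then 1 else 0"]) (simp add: if_distrib cong: if_cong)
next
  case (step j)
  then obtain c where c: "\<And>k. k \<le> n \<Longrightarrow> 0 \<le> c k" "\<And>k. k < Suc j \<Longrightarrow> c k = 0"
    and eq: "\<And>z. (\<Prod>h=Suc j..<n. z - \<mu> h) = (\<Sum>k<Suc n. c k * (\<Prod>h=Suc k..<Suc n. z - l h))"
    by auto
  \<comment> \<open>Splitting \<open>z - \<mu> j\<close> as
    \<open>(z - l k) + (l k - \<mu> j)\<close> in summand \<open>k\<close> yields one term that
    moves to index \<open>k - 1\<close> and one that stays.\<close>
  define c' where "c' k = (if k < n then c (Suc k) else 0) + c k * (l k - \<mu> j)" for k
  have "0 \<le> c' k" if k: "k \<le> n" for k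
  proof -
    have "0 \<le> c k * (l k - \<mu> j)"
    proof (cases "k < Suc j")
      case False
      \<comment> \<open>Only indices \<open>k > j\<close> carry weight, and there interlacing and
        the ordering of \<open>l\<close> apply.\<close>
      then have "\<mu> j \<le> l k" using il[of j] l[of "Suc j" k] step k by linarith
      then show ?thesis using c(1)[OF k] by simp
    qed (simp add: c(2))
    then show ?thesis using c(1) k by (auto simp: c'_def)
  qed
  moreover have "c' k = 0" if "k < j" for k using c(2) that by (simp add: c'_def)
  moreover have "(\<Prod>h=j..<n. z - \<mu> h) = (\<Sum>k<Suc n. c' k * (\<Prod>h=Suc k..<Suc n. z - l h))" for z
  proof -
    let ?Q = "\<lambda>k. \<Prod>h=k..<Suc n. z - l h"
    have "(\<Prod>h=j..<n. z - \<mu> h) = (z - \<mu> j) * (\<Prod>h=Suc j..<n. z - \<mu> h)"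
      using step by (simp add: prod.atLeast_Suc_lessThan)
    also have "\<dots> = (\<Sum>k<Suc n. c k * ?Q k + c k * (l k - \<mu> j) * ?Q (Suc k))"
      unfolding eq sum_distrib_left
    proof (rule sum.cong)
      fix k assume "k \<in> {..<Suc n}"
      then have "?Q k = (z - l k) * ?Q (Suc k)" by (subst prod.atLeast_Suc_lessThan) auto
      then show "(z - \<mu> j) * (c k * ?Q (Suc k)) = c k * ?Q k + c k * (l k - \<mu> j) * ?Q (Suc k)"
        by (simp only:) (simp only: algebra_simps)
    qed simp
    also have "\<dots> = (\<Sum>k<Suc n. c k * ?Q k) + (\<Sum>k<Suc n. c k * (l k - \<mu> j) * ?Q (Suc k))"
      by (rule sum.distrib)
    \<comment> \<open>The term \<open>?Q 0\<close>, whose degree is too high for the basis, is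
      absent because \<open>c 0 = 0\<close>.\<close>
    also have "(\<Sum>k<Suc n. c k * ?Q k) = (\<Sum>k<n. c (Suc k) * ?Q (Suc k))"
      unfolding sum.lessThan_Suc_shift using c(2)[of 0] by simp
    also have "\<dots> = (\<Sum>k<Suc n. (if k < n then c (Suc k) else 0) * ?Q (Suc k))"
      unfolding sum.lessThan_Suc by simp
    also have "\<dots> + (\<Sum>k<Suc n. c k * (l k - \<mu> j) * ?Q (Suc k)) = (\<Sum>k<Suc n. c' k * ?Q (Suc k))"
      unfolding c'_def sum.distrib[symmetric] distrib_right ..
    finally show ?thesis .
  qed
  ultimately show ?case by blast
qed

text \<open>The sum is an entry of the product of the factors \<open>A - l h\<close>,
  \<open>h < k\<close>, with \<open>A\<close> compressed to \<open>T\<close>. Off the diagonal,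
  \<open>j\<close> is eliminated and two expansions of column \<open>j\<close> of the adjugate are
  compared.\<close>

lemma newton_product_entries_nonneg:
  fixes A :: "real^'n^'n"
  assumes sym: "transpose A = A" and off: "\<And>i j. i \<noteq> j \<Longrightarrow> 0 \<le> A $ i $ j"
  shows "spectral_system A (coord_space T) (card T) v l \<Longrightarrow> i \<in> T \<Longrightarrow> j \<in> T \<Longrightarrow> k < card T \<Longrightarrow>
    0 \<le> (\<Sum>m<card T. (\<Prod>h<k. l m - l h) * (v m $ i * v m $ j))"
proof (induction "card T" arbitrary: T v l i j k)
  case (Suc n)
  note sysT = Suc.prems(1)[folded Suc.hyps(2)]
  show ?case
  proof (cases "i = j")
    case True
    show ?thesis
    proof (rule sum_nonneg)
      fix m assume m: "m \<in> {..<card T}"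
      \<comment> \<open>Eigenvectors of index below \<open>k\<close> are annihilated; for the others
        all factors are nonnegative by the ordering.\<close>
      have "0 \<le> (\<Prod>h<k. l m - l h)"
      proof (cases "m < k")
        case True
        then have "(\<Prod>h<k. l m - l h) = 0" by (intro prod_zero) auto
        then show ?thesis by (simp only: order_refl)
      next
        case False
        then show ?thesis
          using spectral_system_sorted[OF Suc.prems(1)] m by (intro prod_nonneg) auto
      qed
      then show "0 \<le> (\<Prod>h<k. l m - l h) * (v m $ i * v m $ j)" using True by simp
    qed
  next
    case False
    define S where "S = T - {j}"
    have jS: "j \<notin> S" and T: "T = insert j S" and iS: "i \<in> S" and cS: "n = card S"
      using Suc.prems Suc.hyps(2) False by (auto simp: S_def)
    obtain w \<mu> where sysS: "spectral_system A (coord_space S) n w \<mu>"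
      using spectral_system_exists[OF sym subspace_coord_space[of S]] dim_coord_space[of S] cS by auto
    have il: "\<mu> h \<le> l (Suc h)" if "h < n" for h
      by (rule eigenvalue_interlacing[OF sysT subspace_coord_space _ sysS subspace_coord_space _ that])
        (use dim_coord_space[of T] Suc.hyps(2) in \<open>auto simp: coord_space_def T\<close>)
    define Q where "Q k z = (\<Prod>h=k..<Suc n. z - l h)" for k z
    \<comment> \<open>\<open>a\<close> holds the Newton product entries on \<open>T\<close>, and
      \<open>b\<close> those on \<open>S\<close>, which the induction hypothesis controls.\<close>
    define a where "a k = (\<Sum>m<Suc n. (\<Prod>h<k. l m - l h) * (v m $ i * v m $ j))" for k
    define b where "b s k = (\<Sum>m<n. (\<Prod>h<k. \<mu> m - \<mu> h) * (w m $ s * w m $ i))" for s k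
    have b: "0 \<le> b s k" if "s \<in> S" "k < n" for s k
      using Suc.hyps(1)[OF cS, folded cS, OF sysS that(1) iS that(2)] by (simp add: b_def)
    have "\<exists>c. (\<forall>k\<le>n. 0 \<le> c k) \<and> (\<forall>z. (\<Prod>h=Suc q..<n. z - \<mu> h) = (\<Sum>k<Suc n. c k * Q (Suc k) z))"
      if "q < n" for q
    proof -
      have "\<exists>c. (\<forall>k\<le>n. 0 \<le> c k) \<and> (\<forall>k<Suc q. c k = 0) \<and>
        (\<forall>z. (\<Prod>h=Suc q..<n. z - \<mu> h) = (\<Sum>k<Suc n. c k * (\<Prod>h=Suc k..<Suc n. z - l h)))"
        by (rule newton_basis_interlacing)
          (use spectral_system_sorted[OF sysT] il that in auto)
      then show ?thesis unfolding Q_def by blast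
    qed
    then obtain c where c: "\<And>q k. q < n \<Longrightarrow> k \<le> n \<Longrightarrow> 0 \<le> c q k"
      and ceq: "\<And>q z. q < n \<Longrightarrow> (\<Prod>h=Suc q..<n. z - \<mu> h) = (\<Sum>k<Suc n. c q k * Q (Suc k) z)"
      by metis
    \<comment> \<open>The coefficients predicted by elimination: \<open>c\<close> carries
      \<open>b\<close> into the basis of the larger spectrum, and column \<open>j\<close> of
      \<open>A\<close> weights the result.\<close>
    define X where "X s k = (\<Sum>q<n. b s q * c q k)" for s k
    define d where "d k = (\<Sum>s\<in>S. A $ s $ j * X s k)" for k
    \<comment> \<open>Beyond \<open>Z\<close> no denominator vanishes.\<close>
    define Z where "Z = (\<Sum>h\<le>n. \<bar>l h\<bar>) + (\<Sum>h<n. \<bar>\<mu> h\<bar>)"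
    have "a k - d k = 0"
    proof (rule newton_basis_independent[where Z = Z and n = "Suc n" and l = l and a = "\<lambda>k. a k - d k"])
      fix z assume z: "z > Z"
      have zl: "z \<noteq> l m" if "m \<le> n" for m
      proof -
        have "\<bar>l m\<bar> \<le> (\<Sum>h\<le>n. \<bar>l h\<bar>)" using that by (intro member_le_sum) auto
        moreover have "0 \<le> (\<Sum>h<n. \<bar>\<mu> h\<bar>)" by (simp add: sum_nonneg)
        ultimately show ?thesis using z unfolding Z_def by linarith
      qed
      have zm: "z \<noteq> \<mu> m" if "m < n" for m
      proof -
        have "\<bar>\<mu> m\<bar> \<le> (\<Sum>h<n. \<bar>\<mu> h\<bar>)" using that by (intro member_le_sum) auto
        moreover have "0 \<le> (\<Sum>h\<le>n. \<bar>l h\<bar>)" by (simp add: sum_nonneg)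
        ultimately show ?thesis using z unfolding Z_def by linarith
      qed
      have "(\<Prod>h<Suc n. z - l h) * (\<Sum>m<Suc n. v m $ j * v m $ i / (z - l m)) =
        (\<Sum>m<Suc n. (v m $ i * v m $ j) * ((\<Prod>h<Suc n. z - l h) / (z - l m)))"
        unfolding sum_distrib_left by (rule sum.cong) (simp_all only: times_divide_eq_right mult_ac)
      also have "\<dots> = (\<Sum>m<Suc n. (v m $ i * v m $ j) * (\<Sum>k<Suc n. (\<Prod>h<k. l m - l h) * Q (Suc k) z))"
      proof (rule sum.cong)
        fix m assume "m \<in> {..<Suc n}"
        then show "(v m $ i * v m $ j) * ((\<Prod>h<Suc n. z - l h) / (z - l m)) =
          (v m $ i * v m $ j) * (\<Sum>k<Suc n. (\<Prod>h<k. l m - l h) * Q (Suc k) z)"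
          by (subst newton_resolvent) (use zl in \<open>auto simp: Q_def\<close>)
      qed simp
      also have "\<dots> = (\<Sum>k<Suc n. a k * Q (Suc k) z)"
        unfolding a_def sum_distrib_left sum_distrib_right
        by (subst sum.swap) (simp only: mult_ac)
      finally have lhs: "(\<Prod>h<Suc n. z - l h) * (\<Sum>m<Suc n. v m $ j * v m $ i / (z - l m)) =
        (\<Sum>k<Suc n. a k * Q (Suc k) z)" .
      have inner: "(\<Prod>h<n. z - \<mu> h) * (\<Sum>m<n. w m $ s * w m $ i / (z - \<mu> m)) =
        (\<Sum>k<Suc n. X s k * Q (Suc k) z)" for s
      proof -
        have "(\<Prod>h<n. z - \<mu> h) * (\<Sum>m<n. w m $ s * w m $ i / (z - \<mu> m)) =
          (\<Sum>m<n. (w m $ s * w m $ i) * ((\<Prod>h<n. z - \<mu> h) / (z - \<mu> m)))"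
          unfolding sum_distrib_left by (rule sum.cong) (simp_all only: times_divide_eq_right mult_ac)
        also have "\<dots> = (\<Sum>m<n. (w m $ s * w m $ i) *
            (\<Sum>q<n. (\<Prod>h<q. \<mu> m - \<mu> h) * (\<Prod>h=Suc q..<n. z - \<mu> h)))"
        proof (rule sum.cong)
          fix m assume "m \<in> {..<n}"
          then show "(w m $ s * w m $ i) * ((\<Prod>h<n. z - \<mu> h) / (z - \<mu> m)) = (w m $ s * w m $ i) *
            (\<Sum>q<n. (\<Prod>h<q. \<mu> m - \<mu> h) * (\<Prod>h=Suc q..<n. z - \<mu> h))"
            by (subst newton_resolvent) (use zm in auto)
        qed simp
        also have "\<dots> = (\<Sum>q<n. b s q * (\<Prod>h=Suc q..<n. z - \<mu> h))"
          unfolding b_def sum_distrib_left sum_distrib_right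
          by (subst sum.swap) (simp only: mult_ac)
        also have "\<dots> = (\<Sum>q<n. b s q * (\<Sum>k<Suc n. c q k * Q (Suc k) z))"
          by (rule sum.cong) (simp_all only: ceq lessThan_iff)
        also have "\<dots> = (\<Sum>k<Suc n. X s k * Q (Suc k) z)"
          unfolding X_def sum_distrib_left sum_distrib_right
          by (subst sum.swap) (simp only: mult_ac)
        finally show ?thesis .
      qed
      have "(\<Prod>h<n. z - \<mu> h) * (\<Sum>s\<in>S. A $ s $ j * (\<Sum>m<n. w m $ s * w m $ i / (z - \<mu> m))) =
        (\<Sum>s\<in>S. A $ s $ j * ((\<Prod>h<n. z - \<mu> h) * (\<Sum>m<n. w m $ s * w m $ i / (z - \<mu> m))))"
        by (simp only: sum_distrib_left mult_ac)
      also have "\<dots> = (\<Sum>k<Suc n. d k * Q (Suc k) z)"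
        unfolding inner unfolding d_def sum_distrib_left sum_distrib_right
        by (subst sum.swap) (simp only: mult_ac)
      finally have rhs: "(\<Prod>h<n. z - \<mu> h) *
        (\<Sum>s\<in>S. A $ s $ j * (\<Sum>m<n. w m $ s * w m $ i / (z - \<mu> m))) =
        (\<Sum>k<Suc n. d k * Q (Suc k) z)" .
      have "(\<Sum>k<Suc n. a k * Q (Suc k) z) = (\<Sum>k<Suc n. d k * Q (Suc k) z)"
        using resolvent_column_eliminate[OF sym jS cS sysT[unfolded T] sysS zl zm iS] lhs rhs by simp
      then show "(\<Sum>k<Suc n. (a k - d k) * (\<Prod>h=Suc k..<Suc n. z - l h)) = 0"
        unfolding Q_def left_diff_distrib sum_subtractf by simp
    qed (use Suc in simp)
    moreover have "0 \<le> d k"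
      unfolding d_def X_def
    proof (intro sum_nonneg mult_nonneg_nonneg)
      fix s assume "s \<in> S"
      then show "0 \<le> A $ s $ j" using off[of s j] jS by auto
      fix q assume "q \<in> {..<n}"
      then show "0 \<le> b s q" "0 \<le> c q k" using b \<open>s \<in> S\<close> c Suc by auto
    qed
    ultimately show ?thesis using Suc.hyps(2) by (simp add: a_def)
  qed
qed simp

section \<open>Newton expansion of powers\<close>

lemma segment_pos:
  fixes a x u :: real
  assumes "0 < a" "0 < x" "0 \<le> u" "u \<le> 1"
  shows "0 < a + u * (x - a)"
proof -
  have "a + u * (x - a) = (1 - u) * a + u * x" by (simp add: algebra_simps)
  also have "\<dots> > 0"
    using assms by (cases "u = 0") (auto intro!: add_nonneg_pos mult_nonneg_nonneg)
  finally show ?thesis .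
qed

text \<open>The difference quotient \<open>(f x - f a) / (x - a)\<close> written as \<open>\<integral> f' (a + u (x - a)) du\<close>, which
  also makes sense at \<open>x = a\<close> and shows that it inherits the sign of the derivatives.\<close>

definition difference_quotient :: "(nat \<Rightarrow> real \<Rightarrow> real) \<Rightarrow> real \<Rightarrow> nat \<Rightarrow> real \<Rightarrow> real" where
  "difference_quotient F a k x = integral {0..1} (\<lambda>u. u ^ k * F (Suc k) (a + u * (x - a)))"

context
  fixes F :: "nat \<Rightarrow> real \<Rightarrow> real" and a :: real
  assumes F: "\<And>k x. 0 < x \<Longrightarrow> (F k has_real_derivative F (Suc k) x) (at x)" and a: "0 < a"
begin

lemma derivative_chain_continuous: "continuous_on {0<..} (F k)"
  using F by (auto intro!: continuous_at_imp_continuous_on DERIV_isCont)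

lemma difference_quotient_integrand_continuous:
  "continuous_on ({0<..} \<times> {0..1}) (\<lambda>(x, u). u ^ j * F k (a + u * (x - a)))"
  unfolding split_beta
  by (intro continuous_intros continuous_on_compose2[OF derivative_chain_continuous])
    (auto intro: segment_pos[OF a])

lemma difference_quotient_integrable:
  assumes "0 < x"
  shows "(\<lambda>u. u ^ j * F k (a + u * (x - a))) integrable_on {0..1}"
  by (intro integrable_continuous_real continuous_intros continuous_on_compose2[OF derivative_chain_continuous])
    (auto intro: segment_pos[OF a assms])

text \<open>Differentiation under the integral sign; each derivative in \<open>x\<close> brings out
  one more factor \<open>u\<close>, hence the weight \<open>u ^ k\<close>. The quotients thus form a
  derivative chain again.\<close>

lemma difference_quotient_derivative:
  assumes "0 < x"
  shows "(difference_quotient F a k has_real_derivative difference_quotient F a (Suc k) x) (at x)"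
proof -
  have "((\<lambda>x. integral (cbox 0 1) (\<lambda>u. u ^ k * F (Suc k) (a + u * (x - a)))) has_field_derivative
      integral (cbox 0 1) (\<lambda>u. u ^ Suc k * F (Suc (Suc k)) (a + u * (x - a)))) (at x within {0<..})"
  proof (rule leibniz_rule_field_derivative)
    fix y u :: real assume "y \<in> {0<..}" "u \<in> cbox 0 1"
    then have "0 < a + u * (y - a)" using segment_pos[OF a] by auto
    then have "((\<lambda>y. u ^ k * F (Suc k) (a + u * (y - a))) has_real_derivative
       u ^ Suc k * F (Suc (Suc k)) (a + u * (y - a))) (at y)"
      by (auto intro!: derivative_eq_intros DERIV_chain2[OF F])
    then show "((\<lambda>y. u ^ k * F (Suc k) (a + u * (y - a))) has_field_derivative
       u ^ Suc k * F (Suc (Suc k)) (a + u * (y - a))) (at y within {0<..})"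
      by (rule has_field_derivative_at_within)
  qed (use difference_quotient_integrable difference_quotient_integrand_continuous[of "Suc k"] assms in auto)
  moreover have "at x within {0<..} = at x" by (rule at_within_open) (use assms in auto)
  ultimately show ?thesis unfolding difference_quotient_def[abs_def] cbox_interval by (simp only:)
qed

lemma difference_quotient_eq:
  assumes x: "0 < x"
  shows "F 0 x = F 0 a + (x - a) * difference_quotient F a 0 x"
proof -
  have "((\<lambda>u. (x - a) * F (Suc 0) (a + u * (x - a))) has_integral
      F 0 (a + 1 * (x - a)) - F 0 (a + 0 * (x - a))) {0..1}"
  proof (rule fundamental_theorem_of_calculus)
    fix u :: real assume "u \<in> {0..1}"
    then have "0 < a + u * (x - a)" using segment_pos[OF a x] by auto
    moreover have "((\<lambda>u. a + u * (x - a)) has_real_derivative x - a) (at u)"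
      by (auto intro!: derivative_eq_intros)
    ultimately have "((\<lambda>u. F 0 (a + u * (x - a))) has_real_derivative (x - a) * F (Suc 0) (a + u * (x - a))) (at u)"
      using DERIV_chain2[OF F] by (simp add: mult.commute)
    then show "((\<lambda>u. F 0 (a + u * (x - a))) has_vector_derivative (x - a) * F (Suc 0) (a + u * (x - a)))
        (at u within {0..1})"
      by (simp add: has_real_derivative_iff_has_vector_derivative has_vector_derivative_at_within)
  qed simp
  then have "integral {0..1} (\<lambda>u. (x - a) * F (Suc 0) (a + u * (x - a))) = F 0 x - F 0 a"
    by (auto dest: integral_unique)
  then show ?thesis by (simp add: difference_quotient_def)
qed

lemma difference_quotient_nonneg:
  assumes "\<And>y. 0 < y \<Longrightarrow> 0 \<le> F (Suc k) y" and x: "0 < x"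
  shows "0 \<le> difference_quotient F a k x"
  unfolding difference_quotient_def
  by (rule integral_nonneg[OF difference_quotient_integrable[OF x]])
    (auto intro!: mult_nonneg_nonneg assms segment_pos[OF a x])

end

text \<open>Nodes are split off one at a time: the difference quotients at \<open>l 0\<close> form a
  derivative chain that is nonnegative to one order less, so induction applies to the remaining
  nodes. The \<open>c k\<close> are divided differences; as no division occurs, nodes may
  coincide.\<close>

lemma newton_expansion:
  fixes F :: "nat \<Rightarrow> real \<Rightarrow> real"
  assumes "\<And>k x. 0 < x \<Longrightarrow> (F k has_real_derivative F (Suc k) x) (at x)"
    and "\<And>k x. k \<le> m \<Longrightarrow> 0 < x \<Longrightarrow> 0 \<le> F k x" and "\<And>h. h \<le> m \<Longrightarrow> 0 < l h"
  shows "\<exists>c R. (\<forall>k\<le>m. 0 \<le> c k) \<and>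
    (\<forall>x>0. F 0 x = (\<Sum>k\<le>m. c k * (\<Prod>h<k. x - l h)) + (\<Prod>h\<le>m. x - l h) * R x)"
  using assms
proof (induction m arbitrary: F l)
  case 0
  have "F 0 x = F 0 (l 0) + (x - l 0) * difference_quotient F (l 0) 0 x" if "x > 0" for x
    by (rule difference_quotient_eq[where F = F, OF 0(1) _ that]) (use 0(3) in auto)
  moreover have "0 \<le> F 0 (l 0)" using 0(2,3) by simp
  ultimately show ?case
    by (intro exI[of _ "\<lambda>_. F 0 (l 0)"] exI[of _ "difference_quotient F (l 0) 0"]) auto
next
  case (Suc m)
  let ?G = "difference_quotient F (l 0)"
  have l0: "0 < l 0" using Suc.prems by simp
  have "\<exists>c R. (\<forall>k\<le>m. 0 \<le> c k) \<and>
    (\<forall>x>0. ?G 0 x = (\<Sum>k\<le>m. c k * (\<Prod>h<k. x - l (Suc h))) + (\<Prod>h\<le>m. x - l (Suc h)) * R x)"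
  proof (rule Suc.IH[of ?G "\<lambda>h. l (Suc h)"])
    show "(?G k has_real_derivative ?G (Suc k) x) (at x)" if "0 < x" for k x
      by (rule difference_quotient_derivative[where F = F, OF Suc.prems(1) l0 that])
    show "0 \<le> ?G k x" if "k \<le> m" "0 < x" for k x
      by (rule difference_quotient_nonneg[where F = F, OF Suc.prems(1) l0 Suc.prems(2) that(2)]) (use that in auto)
    show "0 < l (Suc h)" if "h \<le> m" for h using Suc.prems(3) that by simp
  qed
  then obtain c R where c: "\<And>k. k \<le> m \<Longrightarrow> 0 \<le> c k"
    and G: "\<And>x. x > 0 \<Longrightarrow> ?G 0 x = (\<Sum>k\<le>m. c k * (\<Prod>h<k. x - l (Suc h))) + (\<Prod>h\<le>m. x - l (Suc h)) * R x"
    by blast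
  define c' where "c' k = (case k of 0 \<Rightarrow> F 0 (l 0) | Suc j \<Rightarrow> c j)" for k
  have "0 \<le> c' k" if "k \<le> Suc m" for k
    using that c Suc.prems(2)[of 0 "l 0"] l0 by (auto simp: c'_def split: nat.split)
  moreover have "F 0 x = (\<Sum>k\<le>Suc m. c' k * (\<Prod>h<k. x - l h)) + (\<Prod>h\<le>Suc m. x - l h) * R x"
    if x: "x > 0" for x
  proof -
    have "F 0 x = F 0 (l 0) + (x - l 0) * ?G 0 x"
      by (rule difference_quotient_eq[where F = F, OF Suc.prems(1) l0 x])
    also have "\<dots> = F 0 (l 0) + (\<Sum>k\<le>m. c k * ((x - l 0) * (\<Prod>h<k. x - l (Suc h)))) +
        ((x - l 0) * (\<Prod>h\<le>m. x - l (Suc h))) * R x"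
      unfolding G[OF x] by (simp add: distrib_left sum_distrib_left mult_ac)
    also have "\<dots> = (\<Sum>k\<le>Suc m. c' k * (\<Prod>h<k. x - l h)) + (\<Prod>h\<le>Suc m. x - l h) * R x"
      unfolding sum.atMost_Suc_shift prod.atMost_Suc_shift prod.lessThan_Suc_shift
      by (simp add: c'_def)
    finally show ?thesis .
  qed
  ultimately show ?case by blast
qed

section \<open>Newton expansion of real powers and entrywise nonnegativity\<close>

lemma powr_derivative_chain:
  fixes t :: real
  assumes "0 < x"
  shows "((\<lambda>x. (\<Prod>i<k. t - real i) * x powr (t - real k)) has_real_derivative
    (\<Prod>i<Suc k. t - real i) * x powr (t - real (Suc k))) (at x)"
  using assms by (auto intro!: derivative_eq_intros simp: algebra_simps)

lemma powr_newton_expansion: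
  fixes t :: real
  assumes t: "real m \<le> t + 1" and l: "\<And>h. h \<le> m \<Longrightarrow> 0 < l h"
  shows "\<exists>c. (\<forall>k\<le>m. 0 \<le> c k) \<and> (\<forall>j\<le>m. l j powr t = (\<Sum>k\<le>m. c k * (\<Prod>h<k. l j - l h)))"
proof -
  let ?F = "\<lambda>k x. (\<Prod>i<k. t - real i) * x powr (t - real k)"
  have "\<exists>c R. (\<forall>k\<le>m. 0 \<le> c k) \<and>
    (\<forall>x>0. ?F 0 x = (\<Sum>k\<le>m. c k * (\<Prod>h<k. x - l h)) + (\<Prod>h\<le>m. x - l h) * R x)"
  proof (rule newton_expansion)
    fix k and x :: real assume "k \<le> m"
    \<comment> \<open>Every factor has \<open>i \<le> m - 1 \<le> t\<close>; here the bound on the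
      exponent enters.\<close>
    then have "0 \<le> (\<Prod>i<k. t - real i)" using t by (intro prod_nonneg) auto
    then show "0 \<le> ?F k x" by simp
  qed (use powr_derivative_chain l in auto)
  then obtain c R where c: "\<forall>k\<le>m. 0 \<le> c k"
    and eq: "\<And>x. x > 0 \<Longrightarrow> x powr t = (\<Sum>k\<le>m. c k * (\<Prod>h<k. x - l h)) + (\<Prod>h\<le>m. x - l h) * R x"
    by auto
  have "l j powr t = (\<Sum>k\<le>m. c k * (\<Prod>h<k. l j - l h))" if "j \<le> m" for j
  proof -
    have "(\<Prod>h\<le>m. l j - l h) = 0" using that by (intro prod_zero) auto
    then show ?thesis using eq[OF l[OF that]] by simp
  qed
  then show ?thesis using c by blast
qed

text \<open>Derivatives of \<open>x powr t\<close> may be singular at a zero eigenvalue, so the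
  spectrum is shifted by \<open>d > 0\<close> and then \<open>d\<close> tends to 0.\<close>

lemma powr_entries_nonneg:
  fixes A :: "real^'n^'n"
  assumes sym: "transpose A = A" and off: "\<And>i j. i \<noteq> j \<Longrightarrow> 0 \<le> A $ i $ j"
    and sys: "spectral_system A UNIV CARD('n) v l"
    and l: "\<And>m. m < CARD('n) \<Longrightarrow> 0 \<le> l m" and t: "real CARD('n) - 2 \<le> t" "0 < t"
  shows "0 \<le> (\<Sum>m<CARD('n). l m powr t * (v m $ i * v m $ j))"
proof -
  obtain q where q: "CARD('n) = Suc q" by (metis not0_implies_Suc zero_less_card_finite less_irrefl)
  have sys': "spectral_system A (coord_space UNIV) (card (UNIV :: 'n set)) v l"
    using sys by (simp add: coord_space_def)
  have pos: "0 \<le> (\<Sum>m<CARD('n). (l m + d) powr t * (v m $ i * v m $ j))" if d: "d > 0" for d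
  proof -
    \<comment> \<open>With \<open>q = CARD('n) - 1\<close>, the bound on \<open>t\<close> is the one
      the expansion asks for. The shift cancels in \<open>l m - l h\<close>, so the Newton products
      are those of \<open>A\<close> itself.\<close>
    have "0 < l h + d" if "h \<le> q" for h using l[of h] d q that by auto
    then obtain c where c: "\<And>k. k \<le> q \<Longrightarrow> 0 \<le> c k"
      and eq: "\<And>m. m \<le> q \<Longrightarrow> (l m + d) powr t = (\<Sum>k\<le>q. c k * (\<Prod>h<k. l m - l h))"
      using powr_newton_expansion[of q t "\<lambda>h. l h + d"] t q by auto
    have "(\<Sum>m<CARD('n). (l m + d) powr t * (v m $ i * v m $ j)) =
      (\<Sum>m<CARD('n). \<Sum>k\<le>q. c k * ((\<Prod>h<k. l m - l h) * (v m $ i * v m $ j)))"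
      by (rule sum.cong) (auto simp: eq q sum_distrib_right mult.assoc)
    also have "\<dots> = (\<Sum>k\<le>q. c k * (\<Sum>m<CARD('n). (\<Prod>h<k. l m - l h) * (v m $ i * v m $ j)))"
      unfolding sum_distrib_left by (rule sum.swap)
    also have "\<dots> \<ge> 0"
      by (intro sum_nonneg mult_nonneg_nonneg newton_product_entries_nonneg[OF sym off sys'])
        (use c q in auto)
    finally show ?thesis .
  qed
  have "((\<lambda>d. \<Sum>m<CARD('n). (l m + d) powr t * (v m $ i * v m $ j)) \<longlongrightarrow>
     (\<Sum>m<CARD('n). (l m + 0) powr t * (v m $ i * v m $ j))) (at_right 0)"
  proof (intro tendsto_intros tendsto_powr')
    fix m assume "m \<in> {..<CARD('n)}"
    then have "eventually (\<lambda>d. 0 \<le> l m + d) (at_right 0)"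
      using l[of m] by (auto simp: eventually_at_right_field intro!: exI[of _ 1])
    then show "l m + 0 \<noteq> 0 \<or> 0 < t \<and> eventually (\<lambda>d. 0 \<le> l m + d) (at_right 0)" using t by simp
  qed
  moreover have "eventually (\<lambda>d. 0 \<le> (\<Sum>m<CARD('n). (l m + d) powr t * (v m $ i * v m $ j))) (at_right 0)"
    using pos by (auto simp: eventually_at_right_field intro!: exI[of _ 1])
  ultimately show ?thesis
    using tendsto_lowerbound[of _ _ "at_right (0::real)" 0] by auto
qed

section \<open>Powers of positive semidefinite matrices\<close>

definition spectral_form :: "real^'n^'n \<Rightarrow> ('n \<Rightarrow> real) \<Rightarrow> real^'n^'n" where
  "spectral_form U lam = (\<chi> i j. \<Sum>k\<in>UNIV. lam k * U $ i $ k * U $ j $ k)"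

lemma transpose_spectral_form: "transpose (spectral_form U lam) = spectral_form U lam"
  by (simp add: spectral_form_def transpose_def vec_eq_iff mult_ac)

lemma spectral_form_mult:
  "spectral_form U lam *v x = (\<Sum>k\<in>UNIV. (lam k * (x \<bullet> column k U)) *\<^sub>R column k U)"
proof -
  have "(spectral_form U lam *v x) $ i = (\<Sum>k\<in>UNIV. (lam k * (x \<bullet> column k U)) *\<^sub>R column k U) $ i" for i
  proof -
    have "(spectral_form U lam *v x) $ i = (\<Sum>j\<in>UNIV. \<Sum>k\<in>UNIV. lam k * U $ i $ k * U $ j $ k * x $ j)"
      by (simp add: matrix_vector_mult_def spectral_form_def sum_distrib_right)
    also have "\<dots> = (\<Sum>k\<in>UNIV. \<Sum>j\<in>UNIV. lam k * U $ i $ k * U $ j $ k * x $ j)"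
      by (rule sum.swap)
    also have "\<dots> = (\<Sum>k\<in>UNIV. (lam k * (x \<bullet> column k U)) *\<^sub>R column k U) $ i"
      by (simp add: inner_vec_def column_def sum_distrib_left sum_distrib_right mult_ac)
    finally show ?thesis .
  qed
  then show ?thesis by (simp add: vec_eq_iff)
qed

lemma spectral_form_psd:
  assumes "\<And>k. 0 \<le> lam k"
  shows "0 \<le> x \<bullet> (spectral_form U lam *v x)"
  using assms by (auto simp: spectral_form_mult inner_sum_right mult.assoc intro!: sum_nonneg)

lemma orthogonal_matrix_columns:
  fixes U :: "real^'n^'n"
  assumes "orthogonal_matrix U"
  shows "column i U \<bullet> column j U = (if i = j then 1 else 0)"
    and "x = (\<Sum>k\<in>UNIV. (x \<bullet> column k U) *\<^sub>R column k U)"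
proof -
  have "transpose U ** U = mat 1" using assms by (simp add: orthogonal_matrix_def)
  then have "(transpose U ** U) $ i $ j = mat 1 $ i $ j" by simp
  then show "column i U \<bullet> column j U = (if i = j then 1 else 0)"
    by (simp add: matrix_matrix_mult_def transpose_def mat_def inner_vec_def column_def)
  have "spectral_form U (\<lambda>_. 1) = U ** transpose U"
    by (simp add: spectral_form_def matrix_matrix_mult_def transpose_def)
  then have "spectral_form U (\<lambda>_. 1) = mat 1" using assms by (simp add: orthogonal_matrix_def)
  then show "x = (\<Sum>k\<in>UNIV. (x \<bullet> column k U) *\<^sub>R column k U)"
    using spectral_form_mult[of U "\<lambda>_. 1" x] by simp
qed

lemma spectral_form_column:
  fixes U :: "real^'n^'n"
  assumes "orthogonal_matrix U"
  shows "spectral_form U lam *v column k U = lam k *\<^sub>R column k U"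
  unfolding spectral_form_mult orthogonal_matrix_columns(1)[OF assms]
  by (simp add: if_distrib if_distribR cong: if_cong)

text \<open>An enumeration \<open>p\<close> of the index type, sorted by eigenvalue, links the
  unordered columns of \<open>U\<close> to the increasing indexing of
  \<open>spectral_system\<close>.\<close>

lemma spectral_form_system:
  fixes U :: "real^'n^'n"
  assumes U: "orthogonal_matrix U"
  shows "\<exists>p. bij_betw p {..<CARD('n)} UNIV \<and>
    spectral_system (spectral_form U lam) UNIV CARD('n) (\<lambda>m. column (p m) U) (\<lambda>m. lam (p m))"
proof -
  obtain xs :: "'n list" where xs: "set xs = UNIV" "distinct xs"
    using finite_distinct_list[OF finite] by blast
  define p where "p = (!) (sort_key lam xs)"
  have len: "length (sort_key lam xs) = CARD('n)" using xs distinct_card by fastforce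
  have bij: "bij_betw p {..<CARD('n)} UNIV"
    unfolding p_def by (rule bij_betw_nth) (use xs len in auto)
  have sorted: "lam (p i) \<le> lam (p j)" if "i \<le> j" "j < CARD('n)" for i j
    using sorted_nth_mono[of "map lam (sort_key lam xs)" i j] that len by (simp add: p_def)
  have "spectral_system (spectral_form U lam) UNIV CARD('n) (\<lambda>m. column (p m) U) (\<lambda>m. lam (p m))"
    unfolding spectral_system_def
  proof (intro conjI ballI allI impI)
    fix i j assume "i < CARD('n)" "j < CARD('n)"
    then have "p i = p j \<longleftrightarrow> i = j" using bij by (auto simp: bij_betw_def inj_on_def)
    then show "column (p i) U \<bullet> column (p j) U = (if i = j then 1 else 0)"
      using orthogonal_matrix_columns(1)[OF U] by simp
  next
    fix x
    show "x = (\<Sum>i<CARD('n). (x \<bullet> column (p i) U) *\<^sub>R column (p i) U)"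
      using orthogonal_matrix_columns(2)[OF U]
      unfolding sum.reindex_bij_betw[OF bij, of "\<lambda>k. (x \<bullet> column k U) *\<^sub>R column k U"] .
  qed (use sorted in \<open>auto simp: spectral_form_column[OF U]\<close>)
  then show ?thesis using bij by blast
qed

lemma spectral_form_exists:
  fixes A :: "real^'n^'n"
  assumes sym: "transpose A = A" and psd: "\<And>x. 0 \<le> x \<bullet> (A *v x)"
  shows "\<exists>U lam. orthogonal_matrix U \<and> (\<forall>k. 0 \<le> lam k) \<and> A = spectral_form U lam"
proof -
  obtain v l where sys: "spectral_system A (UNIV :: (real^'n) set) CARD('n) v l"
    using spectral_system_exists[OF sym subspace_UNIV] by (auto simp: dim_UNIV)
  obtain f where f: "bij_betw f (UNIV :: 'n set) {..<CARD('n)}"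
    using ex_bij_betw_finite_nat[of "UNIV :: 'n set"] by (auto simp: atLeast0LessThan)
  define U :: "real^'n^'n" where "U = (\<chi> i k. v (f k) $ i)"
  have fk: "f k < CARD('n)" for k using f by (auto simp: bij_betw_def)
  have col: "column k U = v (f k)" for k by (simp add: U_def column_def)
  have ff: "f i = f j \<longleftrightarrow> i = j" for i j using f by (auto simp: bij_betw_def inj_on_def)
  have "transpose U ** U = mat 1"
  proof -
    have "(transpose U ** U) $ i $ j = v (f i) \<bullet> v (f j)" for i j
      by (simp add: matrix_matrix_mult_def transpose_def inner_vec_def U_def)
    then show ?thesis
      using spectral_system_orthonormal[OF sys fk fk] by (simp add: vec_eq_iff mat_def ff)
  qed
  then have orth: "orthogonal_matrix U" by (simp add: orthogonal_matrix)
  have nonneg: "0 \<le> l (f k)" for k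
    using psd[of "v (f k)"] spectral_system_eigen[OF sys fk, of "v (f k)" k]
      spectral_system_orthonormal[OF sys fk fk, of k k] by simp
  have "A = spectral_form U (\<lambda>k. l (f k))"
  proof (rule matrix_eq[THEN iffD2], rule allI)
    fix x
    have eig: "A *v v m = l m *\<^sub>R v m" if "m < CARD('n)" for m
      using spectral_system_eigen[OF sys that] by (intro vector_eq_ldot[THEN iffD1]) auto
    have "A *v x = A *v (\<Sum>m<CARD('n). (x \<bullet> v m) *\<^sub>R v m)"
      using spectral_system_expand[OF sys, of x] by simp
    also have "\<dots> = (\<Sum>m<CARD('n). (x \<bullet> v m) *\<^sub>R (A *v v m))"
      by (simp add: linear_sum[OF matrix_vector_mul_linear] matrix_vector_mult_scaleR)
    also have "\<dots> = (\<Sum>m<CARD('n). (l m * (x \<bullet> v m)) *\<^sub>R v m)"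
      by (rule sum.cong) (simp_all add: eig mult.commute)
    also have "\<dots> = (\<Sum>k\<in>UNIV. (l (f k) * (x \<bullet> v (f k))) *\<^sub>R v (f k))"
      by (rule sum.reindex_bij_betw[OF f, symmetric])
    finally show "A *v x = spectral_form U (\<lambda>k. l (f k)) *v x"
      by (simp add: spectral_form_mult col)
  qed
  then show ?thesis using orth nonneg by (intro exI conjI allI)
qed

text \<open>The choice in \<open>psd_pow\<close> has a witness by the spectral theorem, so the
  chosen matrix comes from some decomposition of \<open>A\<close>.\<close>

lemma psd_pow_spectral:
  fixes A :: "real^'n^'n"
  assumes sym: "transpose A = A" and psd: "\<And>x. 0 \<le> x \<bullet> (A *v x)"
  shows "\<exists>U lam. orthogonal_matrix U \<and> (\<forall>k. 0 \<le> lam k) \<and> A = spectral_form U lam \<and>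
    psd_pow A t = spectral_form U (\<lambda>k. lam k powr t)"
proof -
  let ?P = "\<lambda>B. \<exists>U lam. orthogonal_matrix U \<and> (\<forall>k. 0 \<le> lam k) \<and> A = spectral_form U lam \<and>
    B = spectral_form U (\<lambda>k. lam k powr t)"
  obtain U lam where "orthogonal_matrix U" "\<forall>k. 0 \<le> lam k" "A = spectral_form U lam"
    using spectral_form_exists[OF assms] by blast
  then have "?P (spectral_form U (\<lambda>k. lam k powr t))"
    by (intro exI[of _ U] exI[of _ lam] conjI refl)
  then have "\<exists>B. ?P B" by (rule exI)
  then have "?P (SOME B. ?P B)" by (rule someI_ex)
  then show ?thesis unfolding psd_pow_def spectral_form_def .
qed

theorem doubly_nonneg_psd_pow:
  fixes A :: "real^'n^'n"
  assumes A: "doubly_nonneg A" and t: "real CARD('n) - 2 \<le> t" "0 < t"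
  shows "doubly_nonneg (psd_pow A t)"
proof -
  have sym: "transpose A = A" and psd: "\<And>x. 0 \<le> x \<bullet> (A *v x)" and nn: "\<And>i j. 0 \<le> A $ i $ j"
    using A by (auto simp: doubly_nonneg_def)
  obtain U lam where U: "orthogonal_matrix U" and lam: "\<And>k. 0 \<le> lam k"
    and Aeq: "A = spectral_form U lam" and pow: "psd_pow A t = spectral_form U (\<lambda>k. lam k powr t)"
    using psd_pow_spectral[OF sym psd, of t] by auto
  obtain p where p: "bij_betw p {..<CARD('n)} UNIV"
    and sys: "spectral_system A UNIV CARD('n) (\<lambda>m. column (p m) U) (\<lambda>m. lam (p m))"
    using spectral_form_system[OF U, of lam] unfolding Aeq[symmetric] by auto
  have "0 \<le> spectral_form U (\<lambda>k. lam k powr t) $ i $ j" for i j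
  proof -
    have "spectral_form U (\<lambda>k. lam k powr t) $ i $ j =
      (\<Sum>k\<in>UNIV. lam k powr t * (column k U $ i * column k U $ j))"
      by (simp add: spectral_form_def column_def mult_ac)
    also have "\<dots> = (\<Sum>m<CARD('n). lam (p m) powr t * (column (p m) U $ i * column (p m) U $ j))"
      by (rule sum.reindex_bij_betw[OF p, symmetric])
    also have "\<dots> \<ge> 0"
      by (rule powr_entries_nonneg[OF sym nn sys lam t])
    finally show ?thesis .
  qed
  then show ?thesis
    unfolding doubly_nonneg_def pow by (simp add: transpose_spectral_form spectral_form_psd)
qed

text \<open>The power does not depend on the decomposition: both candidates act alike on every
  column of \<open>U\<close>. This allows the power of a concrete matrix to be evaluated.\<close>

lemma psd_pow_spectral_form:
  fixes U :: "real^'n^'n"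
  assumes U: "orthogonal_matrix U" and lam: "\<And>k. 0 \<le> lam k"
  shows "psd_pow (spectral_form U lam) t = spectral_form U (\<lambda>k. lam k powr t)"
proof -
  let ?A = "spectral_form U lam"
  obtain W \<mu> where W: "orthogonal_matrix W" and Aeq: "?A = spectral_form W \<mu>"
    and pow: "psd_pow ?A t = spectral_form W (\<lambda>k. \<mu> k powr t)"
    using psd_pow_spectral[OF transpose_spectral_form[of U lam] spectral_form_psd[of lam, OF lam], of t]
    by auto
  have "spectral_form W (\<lambda>k. \<mu> k powr t) = spectral_form U (\<lambda>k. lam k powr t)"
  proof (rule matrix_eq[THEN iffD2], rule allI)
    fix x
    let ?f = "\<lambda>U lam x. spectral_form U (\<lambda>k. lam k powr t :: real) *v (x :: real^'n)"
    have eig: "?f W \<mu> (column k U) = ?f U lam (column k U)" for k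
    proof -
      \<comment> \<open>Eigenvectors of a symmetric matrix for distinct eigenvalues are
        orthogonal.\<close>
      have ev: "\<mu> m = lam k" if "column k U \<bullet> column m W \<noteq> 0" for m
      proof -
        have "column m W \<bullet> (?A *v column k U) = column k U \<bullet> (?A *v column m W)"
          by (rule symmetric_dot[OF transpose_spectral_form])
        then have "lam k * (column k U \<bullet> column m W) = \<mu> m * (column k U \<bullet> column m W)"
          unfolding spectral_form_column[OF U] unfolding Aeq spectral_form_column[OF W]
          by (simp add: inner_commute)
        then show ?thesis using that by simp
      qed
      have "?f W \<mu> (column k U) = (\<Sum>m\<in>UNIV. (lam k powr t * (column k U \<bullet> column m W)) *\<^sub>R column m W)"
        unfolding spectral_form_mult by (rule sum.cong) (use ev in auto)
      also have "\<dots> = lam k powr t *\<^sub>R (\<Sum>m\<in>UNIV. (column k U \<bullet> column m W) *\<^sub>R column m W)"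
        by (simp add: scaleR_sum_right)
      also have "\<dots> = ?f U lam (column k U)"
        using orthogonal_matrix_columns(2)[OF W, of "column k U"] spectral_form_column[OF U] by simp
      finally show ?thesis .
    qed
    have x: "x = (\<Sum>k\<in>UNIV. (x \<bullet> column k U) *\<^sub>R column k U)"
      by (rule orthogonal_matrix_columns(2)[OF U])
    show "?f W \<mu> x = ?f U lam x"
      by (subst (1 2) x) (simp only: linear_sum[OF matrix_vector_mul_linear] matrix_vector_mult_scaleR eig)
  qed
  then show ?thesis using pow by simp
qed

section \<open>The path on five vertices\<close>

text \<open>The exponent \<open>s - 1\<close> in the derivative is negative. Used with
  \<open>s = t - 2\<close>.\<close>

lemma powr_sum_strict_decreasing:
  fixes s :: real
  assumes s: "0 < s" "s < 1" and xy: "0 \<le> x" "x < y" "y < 1"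
  shows "(1 + y) powr s + (1 - y) powr s < (1 + x) powr s + (1 - x) powr s"
proof (rule DERIV_neg_imp_decreasing_open[OF xy(2)])
  fix u assume u: "x < u" "u < y"
  have "((\<lambda>u. (1 + u) powr s + (1 - u) powr s) has_real_derivative
      s * ((1 + u) powr (s - 1) - (1 - u) powr (s - 1))) (at u)"
    using u xy by (auto intro!: derivative_eq_intros simp: algebra_simps)
  moreover have "(1 + u) powr (s - 1) < (1 - u) powr (s - 1)"
    by (rule powr_less_mono2_neg) (use u xy s in auto)
  then have "s * ((1 + u) powr (s - 1) - (1 - u) powr (s - 1)) < 0" using s by (simp add: mult_pos_neg)
  ultimately show "\<exists>d. ((\<lambda>u. (1 + u) powr s + (1 - u) powr s) has_real_derivative d) (at u) \<and> d < 0"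
    by blast
qed (use xy in \<open>auto intro!: continuous_intros\<close>)

text \<open>The number is \<open>g (1 / 2)\<close>, where a variable replaces one half in the bases.
  Both \<open>g\<close> and its derivative \<open>g1\<close> vanish at 0, and since
  \<open>r * r = 3\<close> the second derivative is a positive multiple of
  \<open>?k (r * x) - ?k x < 0\<close>. Hence \<open>g1\<close>, and then \<open>g\<close>,
  decreases.\<close>

lemma path_entry_negative:
  fixes t :: real
  assumes t: "2 < t" "t < 3"
  shows "(1 + sqrt 3 / 2) powr t + (1 - sqrt 3 / 2) powr t - 3 * ((3 / 2) powr t + (1 / 2) powr t) + 4 < 0"
proof -
  define r where "r = sqrt 3"
  have r: "1 < r" "r < 2" "r * r = 3" by (auto simp: r_def real_less_lsqrt)
  define g where "g x = (1 + r * x) powr t + (1 - r * x) powr t - 3 * ((1 + x) powr t + (1 - x) powr t) + 4" for x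
  define g1 where "g1 x = r * t * ((1 + r * x) powr (t - 1) - (1 - r * x) powr (t - 1))
     - 3 * t * ((1 + x) powr (t - 1) - (1 - x) powr (t - 1))" for x
  have rx: "r * x < 1" if "x \<le> 1 / 2" for x
    using mult_left_mono[OF that, of r] r by linarith
  have cont: "continuous_on {0..b} g" "continuous_on {0..b} g1" if "b \<le> 1 / 2" for b
    unfolding g_def g1_def using rx that r
    by (auto intro!: continuous_intros simp: add_nonneg_eq_0_iff) (smt (verit) mult_nonneg_nonneg)+
  have dg: "(g has_real_derivative g1 x) (at x)" if "0 \<le> x" "x \<le> 1 / 2" for x
  proof -
    have "0 \<le> r * x" using that r by simp
    then have "0 < 1 + r * x" by linarith
    then show ?thesis
      unfolding g_def g1_def using that rx[of x]
      by (auto intro!: derivative_eq_intros simp: algebra_simps)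
  qed
  have g1neg: "g1 b < 0" if b: "0 < b" "b \<le> 1 / 2" for b
  proof -
    have "g1 b < g1 0"
    proof (rule DERIV_neg_imp_decreasing_open[OF b(1)])
      fix x assume x: "0 < x" "x < b"
      have rx1: "r * x < 1" "x < r * x" using rx[of x] x b r by auto
      then have rx2: "0 < 1 + r * x" using x by linarith
      let ?k = "\<lambda>x. (1 + x) powr (t - 2) + (1 - x) powr (t - 2)"
      have "(g1 has_real_derivative r * r * t * (t - 1) * ?k (r * x) - 3 * t * (t - 1) * ?k x) (at x)"
        unfolding g1_def using x b rx1 rx2
        by (auto intro!: derivative_eq_intros simp: algebra_simps)
      moreover have "?k (r * x) < ?k x"
        by (rule powr_sum_strict_decreasing) (use t x rx1 in auto)
      then have "3 * t * (t - 1) * ?k (r * x) < 3 * t * (t - 1) * ?k x"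
        using t by (intro mult_strict_left_mono) auto
      then have "r * r * t * (t - 1) * ?k (r * x) - 3 * t * (t - 1) * ?k x < 0"
        unfolding r(3) by simp
      ultimately show "\<exists>d. (g1 has_real_derivative d) (at x) \<and> d < 0" by blast
    qed (rule cont(2)[OF b(2)])
    then show ?thesis by (simp add: g1_def)
  qed
  have "g (1 / 2) < g 0"
  proof (rule DERIV_neg_imp_decreasing_open[of 0 "1 / 2"])
    show "\<exists>d. (g has_real_derivative d) (at x) \<and> d < 0" if "0 < x" "x < 1 / 2" for x
      using dg[of x] g1neg[of x] that by auto
  qed (use cont(1) in auto)
  then show ?thesis by (simp add: g_def r_def)
qed

section \<open>The index type \<open>5\<close> and the spectral data of the path\<close>

lemma exhaust_5:
  fixes x :: 5
  shows "x = 1 \<or> x = 2 \<or> x = 3 \<or> x = 4 \<or> x = 5"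
proof (induct x)
  case (of_int z)
  then have "z = 0 \<or> z = 1 \<or> z = 2 \<or> z = 3 \<or> z = 4" by fastforce
  then show ?case by auto
qed

lemma forall_5: "(\<forall>i::5. P i) \<longleftrightarrow> P 1 \<and> P 2 \<and> P 3 \<and> P 4 \<and> P 5"
  by (metis exhaust_5)

lemma UNIV_5: "UNIV = {1, 2, 3, 4, 5::5}"
  using exhaust_5 by auto

lemma sum_5: "sum f (UNIV::5 set) = f 1 + f 2 + f 3 + f 4 + f 5"
  unfolding UNIV_5 by (simp add: ac_simps)

definition fun5 :: "'a \<Rightarrow> 'a \<Rightarrow> 'a \<Rightarrow> 'a \<Rightarrow> 'a \<Rightarrow> 5 \<Rightarrow> 'a" where
  "fun5 a b c d e i = (if i = 1 then a else if i = 2 then b else if i = 3 then c else if i = 4 then d else e)"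

lemma fun5_simps [simp]:
  "fun5 a b c d e 1 = a" "fun5 a b c d e 2 = b" "fun5 a b c d e 3 = c" "fun5 a b c d e 4 = d"
  "fun5 a b c d e 5 = e"
  by (simp_all add: fun5_def)

text \<open>Spectral data of \<open>I + B/2\<close> for the adjacency matrix \<open>B\<close> of the path: the eigenvalues of
  \<open>B\<close> are \<open>2 cos (k \<pi> / 6)\<close>, with eigenvectors \<open>sin (j k \<pi> / 6)\<close>.\<close>

definition path_eigenvectors :: "real^5^5" where
  "path_eigenvectors = (\<chi> i. \<chi> k. fun5
     (fun5 (sqrt 3 / 6) (1 / 2) (sqrt 3 / 3) (1 / 2) (sqrt 3 / 6) k)
     (fun5 (1 / 2) (1 / 2) 0 (- 1 / 2) (- 1 / 2) k)
     (fun5 (sqrt 3 / 3) 0 (- sqrt 3 / 3) 0 (sqrt 3 / 3) k)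
     (fun5 (1 / 2) (- 1 / 2) 0 (1 / 2) (- 1 / 2) k)
     (fun5 (sqrt 3 / 6) (- 1 / 2) (sqrt 3 / 3) (- 1 / 2) (sqrt 3 / 6) k) i)"

definition path_eigenvalues :: "5 \<Rightarrow> real" where
  "path_eigenvalues = fun5 (1 + sqrt 3 / 2) (3 / 2) 1 (1 / 2) (1 - sqrt 3 / 2)"

lemma sqrt3_mult: "sqrt 3 * (sqrt 3 * x) = 3 * (x :: real)"
  by (simp flip: mult.assoc)

text \<open>The columns are the sine vectors divided by their common norm
  \<open>sqrt 3\<close>.\<close>

lemma orthogonal_path_eigenvectors: "orthogonal_matrix path_eigenvectors"
  unfolding orthogonal_matrix vec_eq_iff forall_5
  by (simp add: matrix_matrix_mult_def transpose_def mat_def path_eigenvectors_def sum_5 sqrt3_mult)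

lemma path_spectral_form:
  "spectral_form path_eigenvectors path_eigenvalues $ i $ j =
    fun5 (fun5 1 (1 / 2) 0 0 0 j) (fun5 (1 / 2) 1 (1 / 2) 0 0 j) (fun5 0 (1 / 2) 1 (1 / 2) 0 j)
      (fun5 0 0 (1 / 2) 1 (1 / 2) j) (fun5 0 0 0 (1 / 2) 1 j) i"
proof -
  have "\<forall>i j. spectral_form path_eigenvectors path_eigenvalues $ i $ j =
    fun5 (fun5 1 (1 / 2) 0 0 0 j) (fun5 (1 / 2) 1 (1 / 2) 0 0 j) (fun5 0 (1 / 2) 1 (1 / 2) 0 j)
      (fun5 0 0 (1 / 2) 1 (1 / 2) j) (fun5 0 0 0 (1 / 2) 1 j) i"
    unfolding forall_5
    by (simp add: spectral_form_def path_eigenvectors_def path_eigenvalues_def sum_5 algebra_simps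
        sqrt3_mult)
  then show ?thesis by blast
qed

lemma path_eigenvalues_nonneg: "0 \<le> path_eigenvalues k"
proof -
  have "sqrt 3 \<le> 2" by (rule real_le_lsqrt) auto
  then have "\<forall>k. 0 \<le> path_eigenvalues k"
    unfolding forall_5 by (simp add: path_eigenvalues_def)
  then show ?thesis by blast
qed

lemma doubly_nonneg_path: "doubly_nonneg (spectral_form path_eigenvectors path_eigenvalues)"
proof -
  have "\<forall>i j. 0 \<le> spectral_form path_eigenvectors path_eigenvalues $ i $ j"
    unfolding forall_5 path_spectral_form by simp
  then show ?thesis
    unfolding doubly_nonneg_def
    by (simp add: transpose_spectral_form spectral_form_psd path_eigenvalues_nonneg)
qed

lemma not_doubly_nonneg_path_pow:
  assumes "2 < t" "t < 3"
  shows "\<not> doubly_nonneg (psd_pow (spectral_form path_eigenvectors path_eigenvalues) t)"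
proof -
  \<comment> \<open>Products of first and last eigenvector entries give the weights 1, -3, 4, -3, 1
    over 12; the eigenvalue 1 contributes the constant 4.\<close>
  have "psd_pow (spectral_form path_eigenvectors path_eigenvalues) t $ 1 $ 5 =
    ((1 + sqrt 3 / 2) powr t + (1 - sqrt 3 / 2) powr t - 3 * ((3 / 2) powr t + (1 / 2) powr t) + 4) / 12"
    unfolding psd_pow_spectral_form[OF orthogonal_path_eigenvectors path_eigenvalues_nonneg]
    by (simp add: spectral_form_def path_eigenvectors_def path_eigenvalues_def sum_5 field_simps
        sqrt3_mult)
  also have "\<dots> < 0" using path_entry_negative[OF assms] by simp
  finally show ?thesis unfolding doubly_nonneg_def using leD by blast
qed

theorem theorem4p1:
  shows "(3::real) \<in> crit_exp_set TYPE(5) \<and> (\<forall>m \<in> crit_exp_set TYPE(5). 3 \<le> m)"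
proof (intro conjI ballI)
  show "(3::real) \<in> crit_exp_set TYPE(5)"
    \<comment> \<open>\<open>CARD(5) = 5\<close> turns the general bound \<open>n - 2\<close> into
      3.\<close>
    unfolding crit_exp_set_def by (auto intro!: doubly_nonneg_psd_pow)
next
  fix m assume m: "m \<in> crit_exp_set TYPE(5)"
  show "3 \<le> m"
  proof (rule ccontr)
    assume "\<not> 3 \<le> m"
    \<comment> \<open>At least \<open>m\<close>, yet strictly between 2 and 3, where the path is a
      counterexample.\<close>
    define t where "t = max m (5 / 2)"
    have t: "m \<le> t" "2 < t" "t < 3" using \<open>\<not> 3 \<le> m\<close> by (auto simp: t_def)
    then have "doubly_nonneg (psd_pow (spectral_form path_eigenvectors path_eigenvalues) t)"
      using m doubly_nonneg_path unfolding crit_exp_set_def by auto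
    then show False using not_doubly_nonneg_path_pow t by blast
  qed
qed

end
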